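(* Let $0<r\le1$, $0\le\rho,\delta\le1$, and $k\in\mathbb{N}$ with $k>\frac n2$. Let $a\in S^m_{\rho,\delta,0,2k}(\mathbb{T}^n\times\mathbb{Z}^n)$. Let $X^{(n)}$ be either $L^p(\mathbb{T}^n)$ with $1\le p\le2$, or, when $n=1$, $X^{(1)}=B^s_{\infty,\infty}(\mathbb{T})$ with $0<s<1$. Assume $0\le w_2<2k-n$, $m<-\frac nr-w_2-2k\delta$, $1\le p_2\le\infty$, $1\le q_2\le\infty$. Then $T_a:X^{(n)}\to B^{w_2}_{p_2,q_2}(\mathbb{T}^n)$ is $r$-nuclear.
   Context: Toroidal Fourier transform $\widehat f(\xi)=\int_{\mathbb{T}^n}e^{-i2\pi x\cdot\xi}f(x)dx$, $\langle\xi\rangle=(1+|\xi|^2)^{1/2}$. $S^m_{\rho,\delta,0,\mu}(\mathbb{T}^n\times\mathbb{Z}^n)$: functions $a(x,\xi)$ smooth in $x$ for each $\xi\in\mathbb{Z}^n$ with $|\partial_x^\beta a(x,\xi)|\le C_\beta\langle\xi\rangle^{m+\delta|\beta|}$ for $|\beta|\le\mu$. $T_au(x)=\sum_{\xi\in\mathbb{Z}^n}e^{i2\pi x\cdot\xi}a(x,\xi)\widehat u(\xi)$. Periodic Besov spaces: $\|f\|_{B^w_{p,q}}=\big(\sum_{m\ge0}2^{mwq}\|\sum_{2^m\le|\xi|<2^{m+1}}e^{i2\pi x\cdot\xi}\widehat f(\xi)\|^q_{L^p(\mathbb{T}^n)}\big)^{1/q}$, and for $q=\infty$, $\|f\|_{B^w_{p,\infty}}=\sup_{m\in\mathbb{N}}2^{mw}\|\sum_{2^m\le|\xi|<2^{m+1}}e^{i2\pi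 x\cdot\xi}\widehat f(\xi)\|_{L^p(\mathbb{T}^n)}$. The paper identifies $B^s_{\infty,\infty}(\mathbb{T})$, $0<s<1$, with the Hölder space $\Lambda^s(\mathbb{T})$ normed by $\sup_{x,h}|f(x+h)-f(x)||h|^{-s}+\sup_x|f(x)|$. $T:E\to F$ is $r$-nuclear if $T=\sum_ne'_n(\cdot)y_n$ with $\sum_n\|e'_n\|^r_{E'}\|y_n\|^r_F<\infty$. *)

theory Defs
  imports "HOL-Analysis.Analysis" "HOL-Probability.Essential_Supremum"
begin

text \<open>The torus T^n is represented by the unit cube [0,1]^n in real^'n (with n = CARD('n));
  functions on T^n are complex-valued functions on real^'n, integrated over the cube.
  Lattice points xi in Z^n are elements of int^'n.\<close>

definition cube :: "(real^'n) set" where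
  "cube = cbox 0 One"

definition torus_measure :: "(real^'n) measure" where
  "torus_measure = lebesgue_on cube"

definition pair :: "real^'n \<Rightarrow> int^'n \<Rightarrow> real" where
  "pair x \<xi> = (\<Sum>i\<in>UNIV. x$i * real_of_int (\<xi>$i))"

definition lnorm :: "int^'n \<Rightarrow> real" where
  "lnorm \<xi> = sqrt (\<Sum>i\<in>UNIV. (real_of_int (\<xi>$i))^2)"

definition japan :: "int^'n \<Rightarrow> real" where
  "japan \<xi> = sqrt (1 + (\<Sum>i\<in>UNIV. (real_of_int (\<xi>$i))^2))"

definition fcoef :: "(real^'n \<Rightarrow> complex) \<Rightarrow> int^'n \<Rightarrow> complex" where
  "fcoef f \<xi> = integral\<^sup>L torus_measure (\<lambda>x. cis (- 2 * pi * pair x \<xi>) * f x)"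

text \<open>Partial derivatives in x, iterated along a list of coordinate directions
  (a multi-index beta corresponds to a list of length |beta|).\<close>
definition pd :: "'n \<Rightarrow> (real^'n \<Rightarrow> complex) \<Rightarrow> real^'n \<Rightarrow> complex" where
  "pd i f x = vector_derivative (\<lambda>t. f (x + t *\<^sub>R axis i 1)) (at 0)"

fun pds :: "'n list \<Rightarrow> (real^'n \<Rightarrow> complex) \<Rightarrow> real^'n \<Rightarrow> complex" where
  "pds [] f = f"
| "pds (i # is) f = pd i (pds is f)"

definition smooth :: "(real^'n \<Rightarrow> complex) \<Rightarrow> bool" where
  "smooth f \<longleftrightarrow> (\<forall>is. continuous_on UNIV (pds is f) \<and>
      (\<forall>i x. (\<lambda>t. pds is f (x + t *\<^sub>R axis i 1)) differentiable (at 0)))"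

definition periodic :: "(real^'n \<Rightarrow> complex) \<Rightarrow> bool" where
  "periodic f \<longleftrightarrow> (\<forall>x i. f (x + axis i 1) = f x)"

definition symbol_class ::
  "real \<Rightarrow> real \<Rightarrow> real \<Rightarrow> nat \<Rightarrow> (real^'n \<Rightarrow> int^'n \<Rightarrow> complex) \<Rightarrow> bool" where
  "symbol_class m \<rho> \<delta> \<mu> a \<longleftrightarrow>
     (\<forall>\<xi>. smooth (\<lambda>x. a x \<xi>) \<and> periodic (\<lambda>x. a x \<xi>)) \<and>
     (\<forall>is. length is \<le> \<mu> \<longrightarrow>
        (\<exists>C. \<forall>x \<xi>. norm (pds is (\<lambda>y. a y \<xi>) x) \<le> C * japan \<xi> powr (m + \<delta> * real (length is))))"

definition Top :: "(real^'n \<Rightarrow> int^'n \<Rightarrow> complex) \<Rightarrow> (real^'n \<Rightarrow> complex) \<Rightarrow> real^'n \<Rightarrow> complex" where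
  "Top a u x = (\<Sum>\<^sub>\<infinity>\<xi>\<in>UNIV. cis (2 * pi * pair x \<xi>) * a x \<xi> * fcoef u \<xi>)"

definition Lp_space :: "real \<Rightarrow> (real^'n \<Rightarrow> complex) set" where
  "Lp_space p = {f. f \<in> borel_measurable torus_measure \<and>
                     integrable torus_measure (\<lambda>x. norm (f x) powr p)}"

definition Lp_norm :: "real \<Rightarrow> (real^'n \<Rightarrow> complex) \<Rightarrow> real" where
  "Lp_norm p f = (integral\<^sup>L torus_measure (\<lambda>x. norm (f x) powr p)) powr (1 / p)"

definition Lp_norm_ext :: "ereal \<Rightarrow> (real^'n \<Rightarrow> complex) \<Rightarrow> real" where
  "Lp_norm_ext p f = (if p = \<infinity> then real_of_ereal (esssup torus_measure (\<lambda>x. ereal (norm (f x))))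
                      else Lp_norm (real_of_ereal p) f)"

definition dyadic_block :: "nat \<Rightarrow> (real^'n \<Rightarrow> complex) \<Rightarrow> real^'n \<Rightarrow> complex" where
  "dyadic_block j f x = (\<Sum>\<xi>\<in>{\<xi>::int^'n. 2 ^ j \<le> lnorm \<xi> \<and> lnorm \<xi> < 2 ^ (j + 1)}.
                          cis (2 * pi * pair x \<xi>) * fcoef f \<xi>)"

definition besov_seq :: "real \<Rightarrow> ereal \<Rightarrow> (real^'n \<Rightarrow> complex) \<Rightarrow> nat \<Rightarrow> real" where
  "besov_seq w p f j = 2 powr (real j * w) * Lp_norm_ext p (dyadic_block j f)"

definition Besov_space :: "real \<Rightarrow> ereal \<Rightarrow> ereal \<Rightarrow> (real^'n \<Rightarrow> complex) set" where
  "Besov_space w p q = {f. integrable torus_measure f \<and>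
      (if q = \<infinity> then bdd_above (range (besov_seq w p f))
       else summable (\<lambda>j. besov_seq w p f j powr real_of_ereal q))}"

definition Besov_norm :: "real \<Rightarrow> ereal \<Rightarrow> ereal \<Rightarrow> (real^'n \<Rightarrow> complex) \<Rightarrow> real" where
  "Besov_norm w p q f = (if q = \<infinity> then (SUP j. besov_seq w p f j)
       else (\<Sum>j. besov_seq w p f j powr real_of_ereal q) powr (1 / real_of_ereal q))"

text \<open>Hoelder space Lambda^s(T) (identified in the paper with B^s_{infinity,infinity}(T)).\<close>
definition Holder_space :: "real \<Rightarrow> (real^'n \<Rightarrow> complex) set" where
  "Holder_space s = {f. periodic f \<and>
      bdd_above {norm (f (x + h) - f x) / norm h powr s | x h. h \<noteq> 0} \<and>
      bdd_above (range (\<lambda>x. norm (f x)))}"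

definition Holder_norm :: "real \<Rightarrow> (real^'n \<Rightarrow> complex) \<Rightarrow> real" where
  "Holder_norm s f = Sup {norm (f (x + h) - f x) / norm h powr s | x h. h \<noteq> 0}
                     + (SUP x. norm (f x))"

definition clinear_on :: "('a \<Rightarrow> complex) set \<Rightarrow> (('a \<Rightarrow> complex) \<Rightarrow> complex) \<Rightarrow> bool" where
  "clinear_on E e \<longleftrightarrow> (\<forall>u\<in>E. \<forall>v\<in>E. e (\<lambda>x. u x + v x) = e u + e v) \<and>
                       (\<forall>u\<in>E. \<forall>c. e (\<lambda>x. c * u x) = c * e u)"

definition dual_norm ::
  "('a \<Rightarrow> complex) set \<Rightarrow> (('a \<Rightarrow> complex) \<Rightarrow> real) \<Rightarrow> (('a \<Rightarrow> complex) \<Rightarrow> complex) \<Rightarrow> real" where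
  "dual_norm E nE e = Sup ((\<lambda>u. norm (e u)) ` {u\<in>E. nE u \<le> 1})"

definition continuous_functional ::
  "('a \<Rightarrow> complex) set \<Rightarrow> (('a \<Rightarrow> complex) \<Rightarrow> real) \<Rightarrow> (('a \<Rightarrow> complex) \<Rightarrow> complex) \<Rightarrow> bool" where
  "continuous_functional E nE e \<longleftrightarrow> clinear_on E e \<and> bdd_above ((\<lambda>u. norm (e u)) ` {u\<in>E. nE u \<le> 1})"

definition r_nuclear ::
  "real \<Rightarrow> ('a \<Rightarrow> complex) set \<Rightarrow> (('a \<Rightarrow> complex) \<Rightarrow> real) \<Rightarrow>
   ('b \<Rightarrow> complex) set \<Rightarrow> (('b \<Rightarrow> complex) \<Rightarrow> real) \<Rightarrow>
   (('a \<Rightarrow> complex) \<Rightarrow> ('b \<Rightarrow> complex)) \<Rightarrow> bool" where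
  "r_nuclear r E nE F nF T \<longleftrightarrow> T ` E \<subseteq> F \<and>
     (\<exists>e y. (\<forall>j::nat. continuous_functional E nE (e j)) \<and> (\<forall>j. y j \<in> F) \<and>
        summable (\<lambda>j. dual_norm E nE (e j) powr r * nF (y j) powr r) \<and>
        (\<forall>u\<in>E. (\<lambda>N. nF (\<lambda>x. T u x - (\<Sum>j<N. e j u * y j x))) \<longlonglongrightarrow> 0))"

end

theory Submission
  imports Defs
begin

text \<open>Enumerate the lattice as \<open>\<xi>\<^sub>0, \<xi>\<^sub>1, \<dots>\<close>; the nuclear decomposition is
  \<open>T\<^sub>a u = \<Sum>\<^sub>j e\<^sub>j(u) y\<^sub>j\<close> with \<open>e\<^sub>j\<close> the Fourier coefficient at \<open>\<xi>\<^sub>j\<close>, bounded on \<open>X\<close> because \<open>X\<close> embeds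
  into \<open>L\<^sup>1\<close>, and \<open>y\<^sub>j\<close> the character of frequency \<open>\<xi>\<^sub>j\<close> times \<open>a(\<cdot>, \<xi>\<^sub>j)\<close>. The \<open>\<ell>\<^sup>1\<close> norm of the Fourier
  coefficients with weight \<open>\<langle>\<eta>\<rangle>\<^sup>w\<close> dominates every Besov norm \<open>B\<^sup>w\<^sub>p\<^sub>,\<^sub>q\<close>. The \<open>2k\<close> bounded derivatives of the symbol
  make its Fourier coefficients decay like \<open>\<langle>\<zeta>\<rangle>\<close> to the power \<open>-2k\<close>, and since \<open>2k - w > n\<close> the weighted norm
  of \<open>y\<^sub>j\<close> is \<open>O(\<langle>\<xi>\<^sub>j\<rangle>\<^sup>\<sigma>)\<close> with \<open>\<sigma> = m + 2k\<delta> + w < -n/r\<close>, whose \<open>r\<close>-th powers are summable.\<close>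

section \<open>Fourier coefficients on the torus\<close>

lemma space_torus_measure [simp]: "space torus_measure = cube"
  by (simp add: torus_measure_def)

lemma finite_measure_torus: "finite_measure (torus_measure :: (real^'n) measure)"
  unfolding torus_measure_def cube_def by (intro finite_measure_lebesgue_on) simp

lemma measure_torus_cube [simp]: "measure torus_measure (cube :: (real^'n) set) = 1"
proof -
  have "measure torus_measure (cube :: (real^'n) set) = measure lebesgue (cube :: (real^'n) set)"
    unfolding torus_measure_def cube_def by (intro measure_restrict_space) auto
  also have "\<dots> = 1"
    unfolding cube_def by (simp add: content_cbox_if)
  finally show ?thesis .
qed

lemma borel_measurable_torus:
  assumes "continuous_on UNIV f"
  shows "f \<in> borel_measurable (torus_measure :: (real^'n) measure)"
  unfolding torus_measure_def cube_def
  by (intro continuous_imp_measurable_on_sets_lebesgue continuous_on_subset[OF assms]) auto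

lemma integrable_torus_bounded:
  fixes f :: "real^'n \<Rightarrow> 'b :: {banach, second_countable_topology}"
  assumes "f \<in> borel_measurable torus_measure" "\<And>x. norm (f x) \<le> B"
  shows "integrable torus_measure f"
  by (rule finite_measure.integrable_const_bound[OF finite_measure_torus, of _ B])
     (use assms in auto)

lemma integrable_torus_continuous:
  fixes f :: "real^'n \<Rightarrow> 'b :: euclidean_space"
  assumes "continuous_on UNIV f"
  shows "integrable torus_measure f"
proof -
  have "f absolutely_integrable_on (cbox 0 One)"
    by (intro absolutely_integrable_continuous continuous_on_subset[OF assms]) auto
  then show ?thesis
    unfolding torus_measure_def cube_def by (simp add: integrable_restrict_space set_integrable_def)
qed

lemma integral_torus_le:
  fixes f :: "real^'n \<Rightarrow> real"
  assumes "integrable torus_measure f" "\<And>x. f x \<le> B"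
  shows "integral\<^sup>L torus_measure f \<le> B"
proof -
  have "integral\<^sup>L torus_measure f \<le> integral\<^sup>L (torus_measure :: (real^'n) measure) (\<lambda>x. B)"
    using assms finite_measure.integrable_const[OF finite_measure_torus]
    by (intro integral_mono) auto
  then show ?thesis by simp
qed

section \<open>Characters and elementary rules for Fourier coefficients\<close>

lemma continuous_on_pair: "continuous_on A (\<lambda>x. pair x \<xi>)"
  unfolding pair_def by (intro continuous_intros)

lemma continuous_on_character: "continuous_on A (\<lambda>x. cis (c * pair x \<xi>))"
  unfolding cis_conv_exp by (intro continuous_intros continuous_on_pair)

lemma pair_add_axis: "pair (x + t *\<^sub>R axis i 1) \<xi> = pair x \<xi> + t * \<xi> $ i"
proof -
  have "pair (x + t *\<^sub>R axis i 1) \<xi> = pair x \<xi> + (\<Sum>j\<in>UNIV. t * axis i 1 $ j * real_of_int (\<xi>$j))"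
    unfolding pair_def by (simp add: algebra_simps sum.distrib)
  also have "(\<Sum>j\<in>UNIV. t * axis i 1 $ j * real_of_int (\<xi>$j)) = (\<Sum>j\<in>UNIV. if j = i then t * \<xi> $ i else 0)"
    by (intro sum.cong) (auto simp: axis_def)
  finally show ?thesis by simp
qed

lemma pair_diff: "pair x (\<eta> - \<xi>) = pair x \<eta> - pair x \<xi>"
  unfolding pair_def by (simp add: algebra_simps sum_subtractf)

lemma norm_fcoef_le: "norm (fcoef f \<xi>) \<le> integral\<^sup>L torus_measure (\<lambda>x. norm (f x))"
  unfolding fcoef_def
  using integral_norm_bound[of torus_measure "\<lambda>x. cis (- 2 * pi * pair x \<xi>) * f x"]
  by (simp add: norm_mult)

lemma norm_fcoef_le_bound:
  fixes f :: "real^'n \<Rightarrow> complex"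
  assumes "\<And>x. norm (f x) \<le> B"
  shows "norm (fcoef f \<xi>) \<le> B"
proof (cases "integrable torus_measure (\<lambda>x. norm (f x))")
  case True
  then show ?thesis
    using norm_fcoef_le[of f \<xi>] integral_torus_le[of "\<lambda>x. norm (f x)" B] assms by simp
next
  \<comment> \<open>A non-integrable norm has Bochner integral 0 by convention, and B >= 0. This
    covers functions not known to be measurable.\<close>
  case False
  then show ?thesis
    using norm_fcoef_le[of f \<xi>] order_trans[OF norm_ge_zero assms[of 0]]
    by (simp add: not_integrable_integral_eq)
qed

lemma integrable_character_mult:
  fixes f :: "real^'n \<Rightarrow> complex"
  assumes "integrable torus_measure f"
  shows "integrable torus_measure (\<lambda>x. cis (c * pair x \<xi>) * f x)"
proof (rule Bochner_Integration.integrable_bound[OF assms])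
  show "(\<lambda>x. cis (c * pair x \<xi>) * f x) \<in> borel_measurable torus_measure"
    using borel_measurable_torus[OF continuous_on_character] assms
    by (intro borel_measurable_times) auto
qed (simp add: norm_mult)

lemma fcoef_add:
  assumes "integrable torus_measure f" "integrable torus_measure g"
  shows "fcoef (\<lambda>x. f x + g x) \<xi> = fcoef f \<xi> + fcoef g \<xi>"
  unfolding fcoef_def
  using assms[THEN integrable_character_mult, of "- 2 * pi"] by (simp add: distrib_left)

lemma fcoef_mult: "fcoef (\<lambda>x. c * f x) \<xi> = c * fcoef f \<xi>"
  unfolding fcoef_def by (simp add: mult.left_commute)

text \<open>Lets the decay of the coefficients of a(., \<xi>) away from 0 be read as decay, away
  from \<xi>, of those of the function entering the nuclear series.\<close>

lemma fcoef_character_mult: "fcoef (\<lambda>x. cis (2 * pi * pair x \<xi>) * f x) \<eta> = fcoef f (\<eta> - \<xi>)"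
proof -
  have "cis (- 2 * pi * pair x \<eta>) * (cis (2 * pi * pair x \<xi>) * f x) = cis (- 2 * pi * pair x (\<eta> - \<xi>)) * f x" for x
    unfolding mult.assoc[symmetric] cis_mult pair_diff by (simp add: algebra_simps)
  then show ?thesis unfolding fcoef_def by (intro Bochner_Integration.integral_cong refl)
qed

section \<open>Translation invariance for periodic functions\<close>

lemma integral_torus_eq_integral:
  fixes g :: "real^'n \<Rightarrow> complex"
  assumes "continuous_on UNIV g"
  shows "integral\<^sup>L torus_measure g = integral cube g"
  using integrable_torus_continuous[OF assms]
  unfolding torus_measure_def cube_def by (intro lebesgue_integral_eq_integral) auto

text \<open>The translated cube is cut by the hyperplane x_i = 1. The piece below is the part of the
  cube with x_i >= t; the piece above, brought back by one period, is the part with x_i <= t. The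
  two parts fill the cube again.\<close>

lemma integral_cube_shift:
  fixes g :: "real^'n \<Rightarrow> complex"
  assumes cont: "continuous_on UNIV g" and per: "\<And>x. g (x + axis i 1) = g x" and t: "0 \<le> t" "t \<le> 1"
  shows "integral cube (\<lambda>x. g (x + t *\<^sub>R axis i 1)) = integral cube g"
proof -
  define e :: "real^'n" where "e = axis i 1"
  have e: "e \<in> Basis" "\<And>x. x \<bullet> e = x $ i"
    unfolding e_def by (auto simp: inner_axis)
  have e_nth: "e $ j = (if j = i then 1 else 0)" for j
    unfolding e_def by (simp add: axis_def)
  have One: "(\<Sum>b\<in>(Basis :: (real^'n) set). b $ j) = 1" for j
  proof -
    have "(One :: real^'n) $ j = One \<bullet> axis j (1::real)" by (simp only: cart_eq_inner_axis)
    also have "\<dots> = 1" by (simp add: inner_sum_left inner_Basis)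
    finally show ?thesis by simp
  qed
  \<comment> \<open>Every box below arises from the cube by changing the range of the i-th
    coordinate alone, so this one description settles all the set equalities.\<close>
  have box: "x \<in> cbox (\<alpha> *\<^sub>R e) (One + \<beta> *\<^sub>R e) \<longleftrightarrow>
      (\<forall>j. j \<noteq> i \<longrightarrow> 0 \<le> x $ j \<and> x $ j \<le> 1) \<and> \<alpha> \<le> x $ i \<and> x $ i \<le> 1 + \<beta>" for x \<alpha> \<beta>
  proof -
    have split: "(\<forall>j. Q j) \<longleftrightarrow> (\<forall>j. j \<noteq> i \<longrightarrow> Q j) \<and> Q i" for Q by metis
    show ?thesis
      unfolding mem_box_cart by (subst split) (simp add: e_nth One)
  qed
  have cube: "x \<in> cube \<longleftrightarrow> (\<forall>j. j \<noteq> i \<longrightarrow> 0 \<le> x $ j \<and> x $ j \<le> 1) \<and> 0 \<le> x $ i \<and> x $ i \<le> 1" for x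
    using box[of x 0 0] by (simp add: cube_def)
  have int: "g integrable_on cbox u v" for u v
    by (intro integrable_continuous continuous_on_subset[OF cont]) auto
  have "integral cube (\<lambda>x. g (x + t *\<^sub>R e)) = integral (cbox (t *\<^sub>R e) (One + t *\<^sub>R e)) g"
    using integral_shift_cbox[of "t *\<^sub>R e" "t *\<^sub>R e" "One + t *\<^sub>R e" g] by (simp add: cube_def)
  also have "\<dots> = integral (cbox (t *\<^sub>R e) (One + t *\<^sub>R e) \<inter> {x. x \<bullet> e \<le> 1}) g
                + integral (cbox (t *\<^sub>R e) (One + t *\<^sub>R e) \<inter> {x. x \<bullet> e \<ge> 1}) g"
    by (rule integral_split[OF int e(1)])
  also have "cbox (t *\<^sub>R e) (One + t *\<^sub>R e) \<inter> {x. x \<bullet> e \<le> 1} = cube \<inter> {x. x \<bullet> e \<ge> t}"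
    using t by (intro set_eqI) (auto simp: box cube e(2))
  also have "cbox (t *\<^sub>R e) (One + t *\<^sub>R e) \<inter> {x. x \<bullet> e \<ge> 1} = cbox e (One + t *\<^sub>R e)"
    using t by (intro set_eqI) (auto simp: box box[of _ 1, simplified] e(2))
  also have "integral (cbox e (One + t *\<^sub>R e)) g = integral (cbox 0 (One + t *\<^sub>R e - e)) g"
    using integral_shift_cbox[of e e "One + t *\<^sub>R e" g] per by (simp add: e_def)
  also have "cbox 0 (One + t *\<^sub>R e - e) = cube \<inter> {x. x \<bullet> e \<le> t}"
    using t box[of _ 0 "t - 1"] by (intro set_eqI) (auto simp: cube e(2) algebra_simps)
  also have "integral (cube \<inter> {x. x \<bullet> e \<ge> t}) g + integral (cube \<inter> {x. x \<bullet> e \<le> t}) g = integral cube g"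
    unfolding cube_def by (subst add.commute, rule integral_split[OF int e(1), symmetric])
  finally show ?thesis by (simp add: e_def)
qed

lemma fcoef_shift:
  fixes f :: "real^'n \<Rightarrow> complex"
  assumes cont: "continuous_on UNIV f" and per: "periodic f" and t: "0 \<le> t" "t \<le> 1"
  shows "fcoef (\<lambda>x. f (x + t *\<^sub>R axis i 1)) \<xi> = cis (2 * pi * t * \<xi> $ i) * fcoef f \<xi>"
proof -
  define g where "g x = cis (- 2 * pi * pair x \<xi>) * f x" for x
  have g: "continuous_on UNIV g"
    unfolding g_def by (intro continuous_intros continuous_on_character cont)
  \<comment> \<open>A unit step along an axis changes \<open>pair\<close> by an integer, so the
    character is periodic as well.\<close>
  have g_per: "g (x + axis i 1) = g x" for x
  proof -
    have "cis (- 2 * pi * pair (x + axis i 1) \<xi>) = cis (- 2 * pi * pair x \<xi>) * cis (2 * pi * of_int (- \<xi> $ i))"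
      using pair_add_axis[of x 1 i \<xi>] by (simp add: cis_mult algebra_simps)
    then show ?thesis
      using per cis_multiple_2pi[of "of_int (- \<xi> $ i)"] by (simp add: g_def periodic_def del: of_int_minus)
  qed
  \<comment> \<open>The extra phase compensates for moving the character, so that the integrand
    becomes a translate of the periodic function g.\<close>
  have "cis (- 2 * pi * pair x \<xi>) * f (x + t *\<^sub>R axis i 1)
      = cis (2 * pi * t * \<xi> $ i) * g (x + t *\<^sub>R axis i 1)" for x
    unfolding g_def pair_add_axis mult.assoc[symmetric] cis_mult by (simp add: algebra_simps)
  then have "fcoef (\<lambda>x. f (x + t *\<^sub>R axis i 1)) \<xi>
      = cis (2 * pi * t * \<xi> $ i) * integral\<^sup>L torus_measure (\<lambda>x. g (x + t *\<^sub>R axis i 1))"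
    unfolding fcoef_def by simp
  also have "integral\<^sup>L torus_measure (\<lambda>x. g (x + t *\<^sub>R axis i 1)) = integral\<^sup>L torus_measure g"
    using integral_cube_shift[OF g g_per t]
    by (simp add: integral_torus_eq_integral[OF g] integral_torus_eq_integral continuous_on_compose2[OF g] continuous_intros)
  finally show ?thesis unfolding fcoef_def g_def by simp
qed

section \<open>Derivatives and decay of Fourier coefficients\<close>

lemma periodic_pd:
  fixes f :: "real^'n \<Rightarrow> complex"
  assumes "periodic f"
  shows "periodic (pd i f)"
  unfolding periodic_def
proof (intro allI)
  fix x :: "real^'n" and j :: 'n
  have "f (x + axis j 1 + t *\<^sub>R axis i 1) = f (x + t *\<^sub>R axis i 1)" for t
    using assms unfolding periodic_def by (metis add.assoc add.commute)
  then show "pd i f (x + axis j 1) = pd i f x"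
    unfolding pd_def by presburger
qed

lemma periodic_pds: "periodic f \<Longrightarrow> periodic (pds is f)"
  by (induction "is") (auto intro: periodic_pd)

text \<open>\<open>smooth\<close> provides derivatives only at parameter 0 of each line; recentring
  the line at x + t e_i carries this to every t, as the mean value inequality requires.\<close>

lemma has_vector_derivative_pd:
  assumes "\<And>x. (\<lambda>t. f (x + t *\<^sub>R axis i 1)) differentiable (at 0)"
  shows "((\<lambda>t. f (x + t *\<^sub>R axis i 1)) has_vector_derivative pd i f (x + t *\<^sub>R axis i 1)) (at t)"
proof -
  have *: "((\<lambda>s. f (x + t *\<^sub>R axis i 1 + s *\<^sub>R axis i 1)) has_vector_derivative pd i f (x + t *\<^sub>R axis i 1)) (at 0)"
    unfolding pd_def using assms by (simp add: vector_derivative_works)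
  have 1: "((\<lambda>s. s - t) has_vector_derivative 1) (at t)"
    by (auto intro!: derivative_eq_intros)
  have 2: "((\<lambda>s. f (x + t *\<^sub>R axis i 1 + s *\<^sub>R axis i 1)) has_vector_derivative pd i f (x + t *\<^sub>R axis i 1)) (at (t - t))"
    using * by simp
  show ?thesis
    using vector_diff_chain_at[OF 1 2] by (simp add: o_def algebra_simps)
qed

text \<open>Passes from the derivative as a linear approximation to difference quotients;
  \<open>fcoef_pd\<close> applies it both to the function and to the character.\<close>

lemma has_vector_derivative_imp_quotient:
  assumes "(g has_vector_derivative D) (at (0::real))"
  shows "((\<lambda>t. (g t - g 0) /\<^sub>R t) \<longlongrightarrow> D) (at 0)"
proof -
  have "(\<lambda>t. norm (g (0 + t) - g 0 - t *\<^sub>R D) / norm t) \<midarrow>0\<rightarrow> 0"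
    using assms unfolding has_vector_derivative_def has_derivative_at by (rule conjunct2)
  moreover have "norm (g (0 + t) - g 0 - t *\<^sub>R D) / norm t = norm ((g t - g 0) /\<^sub>R t - D)" if "t \<noteq> 0" for t
  proof -
    have "(g t - g 0) /\<^sub>R t - D = (g t - g 0 - t *\<^sub>R D) /\<^sub>R t"
      using that by (simp add: scaleR_diff_right)
    also have "norm \<dots> = norm (g t - g 0 - t *\<^sub>R D) / norm t"
      by (simp add: divide_inverse mult.commute)
    finally show ?thesis by simp
  qed
  then have "\<forall>\<^sub>F t in at 0. norm (g (0 + t) - g 0 - t *\<^sub>R D) / norm t = norm ((g t - g 0) /\<^sub>R t - D)"
    unfolding eventually_at_filter by (intro always_eventually) blast
  ultimately have "((\<lambda>t. norm ((g t - g 0) /\<^sub>R t - D)) \<longlongrightarrow> 0) (at 0)"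
    by (rule Lim_transform_eventually)
  then show ?thesis
    by (rule LIM_zero_cancel[OF tendsto_norm_zero_cancel])
qed

lemma fcoef_pd:
  fixes f :: "real^'n \<Rightarrow> complex"
  assumes cont: "continuous_on UNIV f" and per: "periodic f"
    and diff: "\<And>x. (\<lambda>t. f (x + t *\<^sub>R axis i 1)) differentiable (at 0)"
    and cont': "continuous_on UNIV (pd i f)" and bound: "\<And>x. norm (pd i f x) \<le> B"
  shows "fcoef (pd i f) \<xi> = \<i> * (2 * pi * \<xi> $ i) * fcoef f \<xi>"
proof -
  \<comment> \<open>Instead of integrating by parts, pass to the limit in the difference quotients \<open>q n\<close>, whose Fourier
    coefficients are known from translation invariance.\<close>
  define h :: "nat \<Rightarrow> real" where "h n = inverse (real (Suc n))" for n
  \<comment> \<open>Steps of at most 1 are the range in which \<open>fcoef_shift\<close> applies;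
    positive ones stay inside the punctured filter \<open>at 0\<close>.\<close>
  have h: "h n > 0" "h n \<le> 1" for n by (auto simp: h_def field_simps)
  have h0: "filterlim h (at 0) sequentially"
    unfolding filterlim_at using LIMSEQ_inverse_real_of_nat h
    by (auto simp: h_def[abs_def] less_le)
  define q where "q n x = (f (x + h n *\<^sub>R axis i 1) - f x) / h n" for n x
  have int: "integrable torus_measure f"
    by (rule integrable_torus_continuous[OF cont])
  have cont_shift: "continuous_on UNIV (\<lambda>x. f (x + c))" for c
    by (intro continuous_on_compose2[OF cont] continuous_intros) auto
  have fcoef_q: "fcoef (q n) \<xi> = (cis (2 * pi * h n * \<xi> $ i) - 1) / h n * fcoef f \<xi>" for n
  proof -
    have "fcoef (q n) \<xi> = 1 / h n * fcoef (\<lambda>x. f (x + h n *\<^sub>R axis i 1) + - 1 * f x) \<xi>"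
      unfolding fcoef_mult[symmetric] by (simp add: q_def[abs_def])
    also have "fcoef (\<lambda>x. f (x + h n *\<^sub>R axis i 1) + - 1 * f x) \<xi>
             = fcoef (\<lambda>x. f (x + h n *\<^sub>R axis i 1)) \<xi> + fcoef (\<lambda>x. - 1 * f x) \<xi>"
      using int by (intro fcoef_add integrable_torus_continuous[OF cont_shift]) auto
    also have "\<dots> = (cis (2 * pi * h n * \<xi> $ i) - 1) * fcoef f \<xi>"
      using fcoef_shift[OF cont per, of "h n" i \<xi>] h[of n] fcoef_mult[of "-1" f \<xi>]
      by (simp add: algebra_simps)
    finally show ?thesis by simp
  qed
  \<comment> \<open>Dominated convergence on a finite measure space, with the constant B as
    majorant.\<close>
  have "(\<lambda>n. fcoef (q n) \<xi>) \<longlonglongrightarrow> fcoef (pd i f) \<xi>"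
    unfolding fcoef_def
  proof (rule integral_dominated_convergence)
    show "integrable (torus_measure :: (real^'n) measure) (\<lambda>x. B)"
      using finite_measure.integrable_const[OF finite_measure_torus] .
    show "(\<lambda>x. cis (- 2 * pi * pair x \<xi>) * pd i f x) \<in> borel_measurable torus_measure"
      by (intro borel_measurable_torus continuous_intros continuous_on_character cont')
    show "(\<lambda>x. cis (- 2 * pi * pair x \<xi>) * q n x) \<in> borel_measurable torus_measure" for n
      unfolding q_def using h[of n]
      by (intro borel_measurable_torus continuous_intros continuous_on_character cont_shift cont) auto
    show "AE x in torus_measure. (\<lambda>n. cis (- 2 * pi * pair x \<xi>) * q n x)
            \<longlonglongrightarrow> cis (- 2 * pi * pair x \<xi>) * pd i f x"
    proof (intro AE_I2 tendsto_intros)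
      fix x
      have "((\<lambda>t. f (x + t *\<^sub>R axis i 1)) has_vector_derivative pd i f x) (at 0)"
        using has_vector_derivative_pd[OF diff, where t = 0] by simp
      from has_vector_derivative_imp_quotient[OF this]
      have "((\<lambda>t. (f (x + t *\<^sub>R axis i 1) - f x) /\<^sub>R t) \<longlongrightarrow> pd i f x) (at 0)"
        by simp
      from filterlim_compose[OF this h0]
      show "(\<lambda>n. q n x) \<longlonglongrightarrow> pd i f x"
        by (simp add: q_def scaleR_conv_of_real field_simps)
    qed
    show "AE x in torus_measure. norm (cis (- 2 * pi * pair x \<xi>) * q n x) \<le> B" for n
    proof (intro AE_I2)
      fix x
      \<comment> \<open>Mean value inequality on a segment of length \<open>h n\<close>: the bound
        on the derivative bounds the quotients uniformly in n.\<close>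
      have "norm (f (x + h n *\<^sub>R axis i 1) - f (x + 0 *\<^sub>R axis i 1)) \<le> B * norm (h n - 0)"
      proof (rule differentiable_bound)
        show "((\<lambda>t. f (x + t *\<^sub>R axis i 1)) has_derivative (\<lambda>s. s *\<^sub>R pd i f (x + t *\<^sub>R axis i 1))) (at t within {0..h n})" for t
          using has_vector_derivative_pd[OF diff, of x t]
          unfolding has_vector_derivative_def by (rule has_derivative_at_withinI)
        show "onorm (\<lambda>s. s *\<^sub>R pd i f (x + t *\<^sub>R axis i 1)) \<le> B" for t
          using mult_left_mono[OF bound abs_ge_zero] by (intro onorm_le) (simp add: mult.commute)
      qed (use h[of n] in auto)
      then have "norm (q n x) \<le> B"
        using h[of n] by (simp add: q_def norm_divide divide_le_eq)
      then show "norm (cis (- 2 * pi * pair x \<xi>) * q n x) \<le> B"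
        by (simp add: norm_mult)
    qed
  qed
  moreover have "(\<lambda>n. fcoef (q n) \<xi>) \<longlonglongrightarrow> \<i> * (2 * pi * \<xi> $ i) * fcoef f \<xi>"
    unfolding fcoef_q
  proof (intro tendsto_intros)
    \<comment> \<open>The factor in \<open>fcoef_q\<close> is the difference quotient of this curve
      at 0, and its derivative there is the claimed multiplier.\<close>
    have "((\<lambda>t. cis (2 * pi * t * \<xi> $ i)) has_vector_derivative (2 * pi * \<xi> $ i) *\<^sub>R (\<i> * cis (2 * pi * 0 * \<xi> $ i))) (at 0)"
      unfolding has_vector_derivative_def
      by (auto intro!: derivative_eq_intros simp: algebra_simps)
    from has_vector_derivative_imp_quotient[OF this]
    have "((\<lambda>t. (cis (2 * pi * t * \<xi> $ i) - 1) /\<^sub>R t) \<longlongrightarrow> \<i> * (2 * pi * \<xi> $ i)) (at 0)"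
      by (simp add: scaleR_conv_of_real mult_ac)
    from filterlim_compose[OF this h0]
    show "(\<lambda>n. (cis (2 * pi * h n * \<xi> $ i) - 1) / h n) \<longlonglongrightarrow> \<i> * (2 * pi * \<xi> $ i)"
      by (simp add: scaleR_conv_of_real field_simps)
  qed
  ultimately show ?thesis by (rule LIMSEQ_unique)
qed

text \<open>Iterates \<open>fcoef_pd\<close>. Each round uses a uniform bound on the next derivative
  as majorant, hence the assumption at every order up to l.\<close>

lemma norm_fcoef_pds_replicate:
  fixes f :: "real^'n \<Rightarrow> complex"
  assumes "smooth f" "periodic f"
    and "\<And>j. j \<le> l \<Longrightarrow> \<exists>B. \<forall>x. norm (pds (replicate j i) f x) \<le> B"
  shows "norm (fcoef (pds (replicate l i) f) \<xi>) = (2 * pi * \<bar>\<xi> $ i\<bar>) ^ l * norm (fcoef f \<xi>)"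
  using assms(3)
proof (induction l)
  case (Suc l)
  obtain B where B: "\<And>x. norm (pd i (pds (replicate l i) f) x) \<le> B"
    using Suc.prems[of "Suc l"] by auto
  have "continuous_on UNIV (pds (i # replicate l i) f)"
    using assms(1) unfolding smooth_def by blast
  then have "fcoef (pd i (pds (replicate l i) f)) \<xi> = \<i> * (2 * pi * \<xi> $ i) * fcoef (pds (replicate l i) f) \<xi>"
    using assms(1) by (intro fcoef_pd[OF _ periodic_pds[OF assms(2)] _ _ B]) (auto simp: smooth_def)
  then show ?case
    using Suc by (simp add: norm_mult abs_mult)
qed simp

section \<open>Inequalities for the weight \<langle>\<xi>\<rangle>\<close>

lemma japan_sq: "japan \<xi> ^ 2 = 1 + (\<Sum>i\<in>UNIV. (real_of_int (\<xi>$i))\<^sup>2)"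
  unfolding japan_def by (simp add: sum_nonneg)

lemma japan_ge_1: "japan \<xi> \<ge> 1"
  unfolding japan_def by (simp add: sum_nonneg)

lemma japan_pos [simp]: "japan \<xi> > 0"
  using japan_ge_1[of \<xi>] by linarith

lemma japan_nonzero [simp]: "japan \<xi> \<noteq> 0"
  using japan_pos[of \<xi>] by linarith

lemma lnorm_le_japan: "lnorm \<xi> \<le> japan \<xi>"
  unfolding japan_def lnorm_def by simp

lemma abs_component_le_lnorm: "\<bar>real_of_int (\<xi> $ i)\<bar> \<le> lnorm \<xi>"
  unfolding lnorm_def by (intro real_le_rsqrt) (auto intro!: member_le_sum[where f = "\<lambda>i. (real_of_int (\<xi>$i))\<^sup>2"])

text \<open>A Peetre type inequality, from |x + y|^2 <= 2|x|^2 + 2|y|^2. It serves to split a weight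
  at \<eta> = \<xi> + \<zeta> into weights at \<xi> and \<zeta>.\<close>

lemma japan_add_le: "japan (\<xi> + \<zeta>) \<le> sqrt 2 * japan \<xi> * japan \<zeta>"
proof -
  let ?s = "\<lambda>\<xi>. \<Sum>i\<in>UNIV. (real_of_int (\<xi>$i))\<^sup>2"
  have "?s (\<xi> + \<zeta>) \<le> (\<Sum>i\<in>UNIV. 2 * (real_of_int (\<xi>$i))\<^sup>2 + 2 * (real_of_int (\<zeta>$i))\<^sup>2)"
  proof (rule sum_mono)
    fix i show "(real_of_int ((\<xi> + \<zeta>) $ i))\<^sup>2 \<le> 2 * (real_of_int (\<xi>$i))\<^sup>2 + 2 * (real_of_int (\<zeta>$i))\<^sup>2"
      using zero_le_power2[of "real_of_int (\<xi>$i) - real_of_int (\<zeta>$i)"]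
      by (simp add: power2_eq_square algebra_simps)
  qed
  also have "\<dots> = 2 * ?s \<xi> + 2 * ?s \<zeta>" by (simp add: sum.distrib sum_distrib_left)
  finally have "?s (\<xi> + \<zeta>) \<le> 2 * ?s \<xi> + 2 * ?s \<zeta>" .
  moreover have "0 \<le> ?s \<xi> * ?s \<zeta>" by (intro mult_nonneg_nonneg sum_nonneg) auto
  ultimately have "1 + ?s (\<xi> + \<zeta>) \<le> 2 * (1 + ?s \<xi>) * (1 + ?s \<zeta>)"
    by (simp only: distrib_left distrib_right)
  then have "japan (\<xi> + \<zeta>) ^ 2 \<le> (sqrt 2 * japan \<xi> * japan \<zeta>) ^ 2"
    by (simp add: japan_sq power_mult_distrib)
  then show ?thesis
    by (rule power2_le_imp_le) (simp add: less_imp_le)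
qed

text \<open>Only derivatives along coordinate axes are needed: the largest component of \<open>\<xi>\<close> controls \<open>\<xi>\<close>.\<close>

lemma fcoef_decay:
  fixes f :: "real^'n \<Rightarrow> complex"
  assumes "smooth f" "periodic f"
    and "\<And>i j. j \<le> 2 * k \<Longrightarrow> \<exists>B. \<forall>x. norm (pds (replicate j i) f x) \<le> B"
    and M0: "\<And>x. norm (f x) \<le> M0"
    and M: "\<And>i x. norm (pds (replicate (2 * k) i) f x) \<le> M i"
  shows "norm (fcoef f \<xi>) * japan \<xi> ^ (2 * k) \<le> (real CARD('n) + 1) ^ k * (M0 + (\<Sum>i\<in>UNIV. M i))"
proof -
  have nonneg: "M0 \<ge> 0" "M i \<ge> 0" for i
    using order_trans[OF norm_ge_zero M0] order_trans[OF norm_ge_zero M] by auto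
  obtain i where i: "\<And>j. \<bar>\<xi> $ j\<bar> \<le> \<bar>\<xi> $ i\<bar>"
  proof -
    have "Max (range (\<lambda>j. \<bar>\<xi> $ j\<bar>)) \<in> range (\<lambda>j. \<bar>\<xi> $ j\<bar>)"
      by (intro Max_in) auto
    then obtain i where "Max (range (\<lambda>j. \<bar>\<xi> $ j\<bar>)) = \<bar>\<xi> $ i\<bar>" by (rule rangeE)
    with Max_ge[of "range (\<lambda>j. \<bar>\<xi> $ j\<bar>)"] show ?thesis
      by (intro that[of i]) auto
  qed
  have "(\<Sum>j\<in>UNIV. (real_of_int (\<xi>$j))\<^sup>2) \<le> (\<Sum>j\<in>(UNIV::'n set). (real_of_int (\<xi>$i))\<^sup>2)"
  proof (intro sum_mono)
    fix j show "(real_of_int (\<xi>$j))\<^sup>2 \<le> (real_of_int (\<xi>$i))\<^sup>2"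
      using i[of j] by (simp add: abs_le_square_iff[symmetric])
  qed
  then have sq: "japan \<xi> ^ 2 \<le> 1 + CARD('n) * (real_of_int (\<xi>$i))\<^sup>2"
    by (simp add: japan_sq)
  have "norm (fcoef f \<xi>) * japan \<xi> ^ (2 * k) \<le> (real CARD('n) + 1) ^ k * (M0 + M i)"
  \<comment> \<open>If the largest component is 0, then \<xi> = 0 and the bound M0 suffices.
    Otherwise it is an integer of modulus at least 1, so its square absorbs the summand 1 in
    \<open>sq\<close>; this gives the factor n + 1.\<close>
  proof (cases "\<xi> $ i = 0")
    case True
    then have "japan \<xi> ^ 2 \<le> 1" using sq by simp
    then have "japan \<xi> ^ (2 * k) \<le> 1"
      by (simp add: power_mult power_le_one)
    then have "norm (fcoef f \<xi>) * japan \<xi> ^ (2 * k) \<le> M0 * 1"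
      using nonneg by (intro mult_mono norm_fcoef_le_bound M0) auto
    also have "\<dots> \<le> 1 * (M0 + M i)" using nonneg by simp
    also have "\<dots> \<le> (real CARD('n) + 1) ^ k * (M0 + M i)"
      using nonneg by (intro mult_right_mono one_le_power add_nonneg_nonneg) auto
    finally show ?thesis .
  next
    case False
    then have "1 \<le> \<bar>\<xi> $ i\<bar>" by linarith
    then have "1 \<le> (real_of_int (\<xi>$i))\<^sup>2"
      by (simp add: abs_le_square_iff[of 1, simplified, symmetric])
    with sq have "japan \<xi> ^ 2 \<le> (real CARD('n) + 1) * (real_of_int (\<xi>$i))\<^sup>2"
      by (simp add: algebra_simps)
    then have "(japan \<xi> ^ 2) ^ k \<le> ((real CARD('n) + 1) * (real_of_int (\<xi>$i))\<^sup>2) ^ k"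
      by (intro power_mono) auto
    then have "japan \<xi> ^ (2 * k) \<le> (real CARD('n) + 1) ^ k * \<bar>real_of_int (\<xi>$i)\<bar> ^ (2 * k)"
      by (simp add: power_mult_distrib power_mult)
    also have "\<dots> \<le> (real CARD('n) + 1) ^ k * (2 * pi * \<bar>real_of_int (\<xi>$i)\<bar>) ^ (2 * k)"
    proof (intro mult_left_mono power_mono)
      show "\<bar>real_of_int (\<xi>$i)\<bar> \<le> 2 * pi * \<bar>real_of_int (\<xi>$i)\<bar>"
        using mult_right_mono[of 1 "2 * pi" "\<bar>real_of_int (\<xi>$i)\<bar>"] pi_gt3 by simp
    qed auto
    finally have "norm (fcoef f \<xi>) * japan \<xi> ^ (2 * k) \<le> norm (fcoef f \<xi>) * \<dots>"
      by (intro mult_left_mono) auto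
    also have "\<dots> = (real CARD('n) + 1) ^ k * norm (fcoef (pds (replicate (2 * k) i) f) \<xi>)"
      using norm_fcoef_pds_replicate[OF assms(1-3), of "2 * k" i \<xi>] by (simp add: mult_ac)
    also have "\<dots> \<le> (real CARD('n) + 1) ^ k * (M0 + M i)"
      using norm_fcoef_le_bound[OF M[where i = i], where \<xi> = \<xi>] nonneg by (intro mult_left_mono) (auto intro: add_increasing)
    finally show ?thesis .
  qed
  \<comment> \<open>The direction i varies with \<xi>; summing over all directions gives a bound
    free of it.\<close>
  also have "\<dots> \<le> (real CARD('n) + 1) ^ k * (M0 + (\<Sum>i\<in>UNIV. M i))"
    using nonneg by (intro mult_left_mono add_left_mono) (auto simp: member_le_sum)
  finally show ?thesis .
qed

section \<open>Summability over the lattice\<close>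

text \<open>The cut-off gives the term at 0 the value 1, where \<open>0 powr (- t)\<close> would be
  0; with it the function dominates the same power of \<langle>\<xi>\<rangle> through any single
  component.\<close>

lemma summable_on_int_powr:
  assumes "t > 1"
  shows "(\<lambda>k::int. max 1 \<bar>real_of_int k\<bar> powr (- t)) summable_on UNIV"
proof -
  define h where "h k = max 1 \<bar>real_of_int k\<bar> powr (- t)" for k
  \<comment> \<open>h differs from the series of \<open>real n powr (- t)\<close> only at index 0,
    so the two are compared after a shift by one.\<close>
  have nat: "summable (\<lambda>n. h (int n))"
  proof (subst summable_Suc_iff[symmetric], rule summable_cong[THEN iffD1, OF _ summable_ignore_initial_segment[where k = 1]])
    show "summable (\<lambda>n. real n powr (- t))"
      using assms by (simp add: summable_real_powr_iff)
  qed (auto simp: h_def max_def)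
  then have 1: "h summable_on {0..}"
  proof -
    have "(\<lambda>n. h (int n)) summable_on UNIV"
      using nat by (subst summable_on_UNIV_nonneg_real_iff) (auto simp: h_def)
    moreover have "bij_betw int UNIV {0..}"
      by (rule bij_betwI[where g = nat]) auto
    ultimately show ?thesis by (simp only: summable_on_reindex_bij_betw)
  qed
  have "(\<lambda>k. h (- k)) summable_on {0..}"
    using 1 by (simp add: h_def[abs_def])
  moreover have "bij_betw uminus {0..} {..0::int}"
    by (rule bij_betwI[where g = uminus]) auto
  ultimately have 2: "h summable_on {..0}"
    using summable_on_reindex_bij_betw by blast
  have "h summable_on {..<0}"
    by (rule summable_on_subset_banach[OF 2]) auto
  with 1 have "h summable_on ({0..} \<union> {..<0})"
    by (intro summable_on_Un_disjoint) auto
  moreover have "{0..} \<union> {..<0} = (UNIV :: int set)" by auto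
  ultimately show ?thesis unfolding h_def by simp
qed

text \<open>Write s = n t with t > 1. Since \<langle>\<xi>\<rangle> >= max 1 |\<xi>_i| in every
  direction, the summand is at most a product of one-variable terms, which reduces the claim to
  \<open>summable_on_int_powr\<close>.\<close>

lemma summable_on_japan_powr:
  fixes s :: real
  assumes "s > CARD('n)"
  shows "(\<lambda>\<xi>::int^'n. japan \<xi> powr (- s)) summable_on UNIV"
proof -
  define t where "t = s / CARD('n)"
  define h where "h k = max 1 \<bar>real_of_int k\<bar> powr (- t)" for k
  have t: "t > 1" using assms by (simp add: t_def)
  have h: "h summable_on UNIV"
    using summable_on_int_powr[OF t] by (simp add: h_def[abs_def])
  have h_nonneg: "h k \<ge> 0" for k by (simp add: h_def)
  have le: "japan \<xi> powr (- s) \<le> (\<Prod>i\<in>UNIV. h (\<xi> $ i))" for \<xi> :: "int^'n"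
  proof -
    have "japan \<xi> powr (- s) = (\<Prod>i\<in>(UNIV::'n set). japan \<xi> powr (- t))"
      by (simp add: t_def powr_power[of "japan \<xi>"] less_imp_neq[OF japan_pos, symmetric])
    also have "\<dots> \<le> (\<Prod>i\<in>UNIV. h (\<xi> $ i))"
    proof (intro prod_mono conjI)
      fix i
      show "japan \<xi> powr (- t) \<le> h (\<xi> $ i)"
        unfolding h_def using t japan_ge_1[of \<xi>] order_trans[OF abs_component_le_lnorm lnorm_le_japan, of \<xi> i]
        by (intro powr_mono2') auto
    qed simp
    finally show ?thesis .
  qed
  show ?thesis
  proof (rule nonneg_bdd_above_summable_on)
    show "bdd_above (sum (\<lambda>\<xi>::int^'n. japan \<xi> powr (- s)) ` {F. F \<subseteq> UNIV \<and> finite F})"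
    proof (intro bdd_aboveI[where M = "infsum h UNIV ^ CARD('n)"], clarify)
      fix F :: "(int^'n) set" assume F: "finite F"
      \<comment> \<open>Enlarging F to the product of its projections makes the sum of products
        factorise; each factor is at most the one-dimensional infinite sum.\<close>
      define A where "A i = (\<lambda>\<xi>. \<xi> $ i) ` F" for i
      have A: "finite (A i)" for i using F by (simp add: A_def)
      have "(\<Sum>\<xi>\<in>F. japan \<xi> powr (- s)) \<le> (\<Sum>\<xi>\<in>F. \<Prod>i\<in>UNIV. h (\<xi> $ i))"
        by (intro sum_mono le)
      also have "\<dots> = (\<Sum>g\<in>(\<lambda>\<xi> i. \<xi> $ i) ` F. \<Prod>i\<in>UNIV. h (g i))"
        by (subst sum.reindex) (auto simp: inj_on_def vec_eq_iff fun_eq_iff)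
      also have "\<dots> \<le> (\<Sum>g\<in>(\<Pi>\<^sub>E i\<in>UNIV. A i). \<Prod>i\<in>UNIV. h (g i))"
        using A by (intro sum_mono2 finite_PiE prod_nonneg) (auto simp: A_def h_nonneg)
      also have "\<dots> = (\<Prod>i\<in>UNIV. \<Sum>k\<in>A i. h k)"
        using A by (subst prod_sum_PiE) auto
      also have "\<dots> \<le> (\<Prod>i\<in>(UNIV::'n set). infsum h UNIV)"
        by (intro prod_mono conjI sum_nonneg finite_sum_le_infsum h A h_nonneg) auto
      finally show "(\<Sum>\<xi>\<in>F. japan \<xi> powr (- s)) \<le> infsum h UNIV ^ CARD('n)" by simp
    qed
  qed simp
qed

section \<open>Besov norms\<close>

lemma finite_lnorm_less: "finite {\<xi>::int^'n. lnorm \<xi> < c}"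
proof -
  have "finite {\<xi>::int^'n. \<forall>i. \<xi> $ i \<in> {-\<lceil>c\<rceil>..\<lceil>c\<rceil>}}"
  proof (rule finite_subset)
    show "{\<xi>::int^'n. \<forall>i. \<xi> $ i \<in> {-\<lceil>c\<rceil>..\<lceil>c\<rceil>}} \<subseteq> vec_lambda ` (\<Pi>\<^sub>E i\<in>UNIV. {-\<lceil>c\<rceil>..\<lceil>c\<rceil>})"
      by (intro subsetI image_eqI[where x = "vec_nth _"]) auto
    show "finite (vec_lambda ` (\<Pi>\<^sub>E i\<in>(UNIV::'n set). {-\<lceil>c\<rceil>..\<lceil>c\<rceil>}))"
      by (intro finite_imageI finite_PiE) auto
  qed
  moreover have "{\<xi>::int^'n. lnorm \<xi> < c} \<subseteq> {\<xi>. \<forall>i. \<xi> $ i \<in> {-\<lceil>c\<rceil>..\<lceil>c\<rceil>}}"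
  proof clarify
    fix \<xi> :: "int^'n" and i assume "lnorm \<xi> < c"
    then have "\<bar>real_of_int (\<xi> $ i)\<bar> < c"
      using abs_component_le_lnorm[of \<xi> i] by linarith
    then show "\<xi> $ i \<in> {-\<lceil>c\<rceil>..\<lceil>c\<rceil>}"
      by (simp add: abs_less_iff le_ceiling_iff minus_le_iff) linarith
  qed
  ultimately show ?thesis by (rule finite_subset[rotated])
qed

text \<open>The cube has measure 1, so a uniform bound is also a bound for the L^p norm, whatever p
  is.\<close>

lemma Lp_norm_ext_bounded:
  fixes f :: "real^'n \<Rightarrow> complex"
  assumes p: "1 \<le> p" and cont: "continuous_on UNIV f" and bound: "\<And>x. norm (f x) \<le> B"
  shows "0 \<le> Lp_norm_ext p f" "Lp_norm_ext p f \<le> B"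
proof -
  let ?M = "torus_measure :: (real^'n) measure"
  have B: "B \<ge> 0" using order_trans[OF norm_ge_zero bound[of 0]] .
  have meas: "(\<lambda>x. ereal (norm (f x))) \<in> borel_measurable ?M"
    using borel_measurable_torus[OF cont] by measurable
  have "0 \<le> Lp_norm_ext p f \<and> Lp_norm_ext p f \<le> B"
  proof (cases "p = \<infinity>")
    case True
    \<comment> \<open>On a space of measure 0 the essential supremum of a constant would be
      -\<infinity>.\<close>
    have "emeasure ?M (space ?M) \<noteq> 0"
      using measure_torus_cube[where 'n = 'n] by (auto simp: measure_def)
    then have "(0::ereal) = esssup ?M (\<lambda>x. 0)"
      by (simp add: esssup_const)
    also have "\<dots> \<le> esssup ?M (\<lambda>x. ereal (norm (f x)))"
      by (intro esssup_mono) auto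
    finally have "0 \<le> esssup ?M (\<lambda>x. ereal (norm (f x)))" .
    moreover have "esssup ?M (\<lambda>x. ereal (norm (f x))) \<le> ereal B"
      using meas bound by (intro esssup_I) auto
    ultimately show ?thesis
      using True by (cases "esssup ?M (\<lambda>x. ereal (norm (f x)))") (auto simp: Lp_norm_ext_def)
  next
    case False
    then obtain q where q: "p = ereal q" "q \<ge> 1" using p by (cases p) auto
    let ?I = "integral\<^sup>L ?M (\<lambda>x. norm (f x) powr q)"
    have le: "norm (f x) powr q \<le> B powr q" for x
      using bound q by (intro powr_mono2) auto
    have "integrable ?M (\<lambda>x. norm (f x) powr q)"
      using borel_measurable_torus[OF cont] le by (intro integrable_torus_bounded[where B = "B powr q"]) auto
    then have "?I \<le> B powr q"
      using le by (rule integral_torus_le)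
    moreover have "0 \<le> ?I" by (intro integral_nonneg_AE) auto
    ultimately have "?I powr (1 / q) \<le> (B powr q) powr (1 / q)"
      using q by (intro powr_mono2) auto
    then show ?thesis
      using q B False by (simp add: Lp_norm_ext_def Lp_norm_def powr_powr)
  qed
  then show "0 \<le> Lp_norm_ext p f" "Lp_norm_ext p f \<le> B" by auto
qed

text \<open>The inclusion of l^1 in l^q: each term is at most W, so b^q <= b W^(q-1), and the
  partial sums stay below W^q.\<close>

lemma summable_powr_le:
  fixes b :: "nat \<Rightarrow> real"
  assumes q: "1 \<le> q" and nonneg: "\<And>j. 0 \<le> b j" and le: "\<And>N. (\<Sum>j<N. b j) \<le> W"
  shows "summable (\<lambda>j. b j powr q)" "(\<Sum>j. b j powr q) powr (1 / q) \<le> W"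
proof -
  have W: "W \<ge> 0" using le[of 0] by simp
  have b_le: "b j \<le> W" for j
    using le[of "Suc j"] sum_nonneg[of "{..<j}" b] nonneg by simp
  have "(\<Sum>j<N. b j powr q) \<le> W powr q" for N
  proof -
    have "b j powr q \<le> b j * W powr (q - 1)" for j
    proof (cases "b j = 0")
      case False
      then have "b j powr q = b j * b j powr (q - 1)"
        using nonneg[of j] by (simp add: powr_diff)
      also have "\<dots> \<le> b j * W powr (q - 1)"
        using q nonneg b_le by (intro mult_left_mono powr_mono2) auto
      finally show ?thesis .
    qed simp
    then have "(\<Sum>j<N. b j powr q) \<le> (\<Sum>j<N. b j) * W powr (q - 1)"
      unfolding sum_distrib_right by (intro sum_mono)
    also have "\<dots> \<le> W * W powr (q - 1)" by (intro mult_right_mono le) auto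
    also have "\<dots> = W powr q"
      using W by (cases "W = 0") (auto simp: powr_diff)
    finally show ?thesis .
  qed
  then show "summable (\<lambda>j. b j powr q)" and "(\<Sum>j. b j powr q) powr (1 / q) \<le> W"
  proof -
    assume *: "\<And>N. (\<Sum>j<N. b j powr q) \<le> W powr q"
    show s: "summable (\<lambda>j. b j powr q)"
      by (rule summableI_nonneg_bounded[OF _ *]) auto
    have "(\<Sum>j. b j powr q) powr (1 / q) \<le> (W powr q) powr (1 / q)"
      using q s * by (intro powr_mono2 suminf_nonneg suminf_le_const) auto
    then show "(\<Sum>j. b j powr q) powr (1 / q) \<le> W"
      using q W by (simp add: powr_powr)
  qed
qed

text \<open>On the j-th block the sup norm is at most the sum of the moduli of the coefficients, and
  2^(jw) <= \<langle>\<eta>\<rangle>^w there because w >= 0. The blocks are finite and disjoint, so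
  bounds over finite sets F control the l^1 norm of the weighted block norms, and with it every l^q
  norm.\<close>

lemma Besov_weighted_fcoef:
  fixes f :: "real^'n \<Rightarrow> complex"
  assumes w: "0 \<le> w" and p: "1 \<le> p" and q: "1 \<le> q" and int: "integrable torus_measure f"
    and W: "\<And>F. finite F \<Longrightarrow> (\<Sum>\<eta>\<in>F. japan \<eta> powr w * norm (fcoef f \<eta>)) \<le> W"
  shows "f \<in> Besov_space w p q" "0 \<le> Besov_norm w p q f" "Besov_norm w p q f \<le> W"
proof -
  define A where "A j = {\<eta>::int^'n. 2 ^ j \<le> lnorm \<eta> \<and> lnorm \<eta> < 2 ^ (j + 1)}" for j :: nat
  have A_fin: "finite (A j)" for j
    unfolding A_def by (rule finite_subset[OF _ finite_lnorm_less[of "2 ^ (j + 1)"]]) auto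
  have A_disj: "A i \<inter> A j = {}" if "i \<noteq> j" for i j
  proof -
    have "A i \<inter> A j = {}" if "i < j" for i j
    proof -
      have "(2::real) ^ (i + 1) \<le> 2 ^ j" using that by (intro power_increasing) auto
      then show ?thesis by (auto simp: A_def)
    qed
    with that show ?thesis by (metis inf_commute linorder_neqE_nat)
  qed
  define b where "b j = besov_seq w p f j" for j
  define S where "S j = (\<Sum>\<eta>\<in>A j. norm (fcoef f \<eta>))" for j
  have cont: "continuous_on UNIV (dyadic_block j f)" for j
    unfolding dyadic_block_def by (intro continuous_intros continuous_on_character)
  have block: "norm (dyadic_block j f x) \<le> S j" for j x
    unfolding dyadic_block_def S_def A_def by (rule order_trans[OF norm_sum]) (simp add: norm_mult)
  have b_nonneg: "0 \<le> b j" for j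
    unfolding b_def besov_seq_def by (intro mult_nonneg_nonneg Lp_norm_ext_bounded(1)[OF p cont block]) auto
  have b_le: "b j \<le> (\<Sum>\<eta>\<in>A j. japan \<eta> powr w * norm (fcoef f \<eta>))" for j
  proof -
    have "b j \<le> 2 powr (real j * w) * S j"
      unfolding b_def besov_seq_def by (intro mult_left_mono Lp_norm_ext_bounded(2)[OF p cont block]) auto
    also have "\<dots> \<le> (\<Sum>\<eta>\<in>A j. japan \<eta> powr w * norm (fcoef f \<eta>))"
      unfolding S_def sum_distrib_left
    proof (intro sum_mono mult_right_mono)
      fix \<eta> assume "\<eta> \<in> A j"
      then have "2 ^ j \<le> japan \<eta>"
        using lnorm_le_japan[of \<eta>] by (simp add: A_def)
      then have "(2 ^ j) powr w \<le> japan \<eta> powr w"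
        using w by (intro powr_mono2) auto
      then show "2 powr (real j * w) \<le> japan \<eta> powr w"
        by (simp add: powr_powr[symmetric] powr_realpow)
    qed auto
    finally show ?thesis .
  qed
  have sum_b: "(\<Sum>j<N. b j) \<le> W" for N
  proof -
    have "(\<Sum>j<N. b j) \<le> (\<Sum>j<N. \<Sum>\<eta>\<in>A j. japan \<eta> powr w * norm (fcoef f \<eta>))"
      by (intro sum_mono b_le)
    also have "\<dots> = (\<Sum>\<eta>\<in>(\<Union>j<N. A j). japan \<eta> powr w * norm (fcoef f \<eta>))"
      using A_fin A_disj by (intro sum.UNION_disjoint[symmetric]) auto
    also have "\<dots> \<le> W" using A_fin by (intro W) auto
    finally show ?thesis .
  qed
  have b_W: "b j \<le> W" for j
    using sum_b[of "Suc j"] sum_nonneg[of "{..<j}" b] b_nonneg by simp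
  have "f \<in> Besov_space w p q \<and> 0 \<le> Besov_norm w p q f \<and> Besov_norm w p q f \<le> W"
  proof (cases "q = \<infinity>")
    case True
    have bdd: "bdd_above (range b)" using b_W by (intro bdd_aboveI[of _ W]) auto
    have "0 \<le> (SUP j. b j)" using bdd b_nonneg by (intro cSUP_upper2[of _ _ 0]) auto
    moreover have "(SUP j. b j) \<le> W" using b_W by (intro cSUP_least) auto
    ultimately show ?thesis
      using True bdd int by (simp add: Besov_space_def Besov_norm_def b_def[abs_def])
  next
    case False
    then obtain t where t: "q = ereal t" "t \<ge> 1" using q by (cases q) auto
    show ?thesis
      using False t int summable_powr_le[OF t(2) b_nonneg sum_b]
      by (simp add: Besov_space_def Besov_norm_def b_def[abs_def])
  qed
  then show "f \<in> Besov_space w p q" "0 \<le> Besov_norm w p q f" "Besov_norm w p q f \<le> W" by auto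
qed

text \<open>A triangle inequality for infinite series, proved on the Fourier side: coefficients are
  computed term by term, and the weighted sum over finitely many frequencies is exchanged with the
  series. It is meant for the remainders of the nuclear expansion.\<close>

lemma Besov_suminf:
  fixes y :: "nat \<Rightarrow> real^'n \<Rightarrow> complex"
  assumes w: "0 \<le> w" and p: "1 \<le> p" and q: "1 \<le> q"
    and cont: "\<And>j. continuous_on UNIV (y j)" and bound: "\<And>j x. norm (y j x) \<le> Z j"
    and wbound: "\<And>j F. finite F \<Longrightarrow> (\<Sum>\<eta>\<in>F. japan \<eta> powr w * norm (fcoef (y j) \<eta>)) \<le> Z j"
    and sum: "summable (\<lambda>j. norm (c j) * Z j)"
  defines "f \<equiv> \<lambda>x. \<Sum>j. c j * y j x"
  shows "f \<in> Besov_space w p q" "0 \<le> Besov_norm w p q f" "Besov_norm w p q f \<le> (\<Sum>j. norm (c j) * Z j)"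
proof -
  let ?M = "torus_measure :: (real^'n) measure"
  have term_le: "norm (c j * y j x) \<le> norm (c j) * Z j" for j x
    using bound by (simp add: norm_mult mult_left_mono)
  have abs_sum: "summable (\<lambda>j. norm (c j * y j x))" for x
    by (rule summable_comparison_test'[OF sum, of 0]) (simp add: term_le del: norm_mult)
  have "f \<in> borel_measurable ?M"
    unfolding f_def using borel_measurable_torus[OF cont] by measurable
  moreover have "norm (f x) \<le> (\<Sum>j. norm (c j) * Z j)" for x
    unfolding f_def using term_le abs_sum sum
    by (intro order_trans[OF summable_norm] suminf_le) auto
  ultimately have int: "integrable ?M f"
    by (rule integrable_torus_bounded)
  \<comment> \<open>The terms are dominated by a summable sequence uniformly in x, so integral and
    series may be exchanged.\<close>
  have fcoef_f: "(\<lambda>j. c j * fcoef (y j) \<eta>) sums fcoef f \<eta>" for \<eta>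
  proof -
    let ?g = "\<lambda>j x. cis (- 2 * pi * pair x \<eta>) * (c j * y j x)"
    have norm_g: "norm (?g j x) = norm (c j * y j x)" for j x by (simp add: norm_mult)
    have int_g: "integrable ?M (?g j)" for j
      by (intro integrable_torus_continuous continuous_intros continuous_on_character cont)
    have "(\<lambda>j. integral\<^sup>L ?M (?g j)) sums (\<integral>x. (\<Sum>j. ?g j x) \<partial>?M)"
    proof (rule sums_integral[OF int_g])
      show "AE x in ?M. summable (\<lambda>j. norm (?g j x))"
        unfolding norm_g using abs_sum by simp
      show "summable (\<lambda>j. \<integral>x. norm (?g j x) \<partial>?M)"
      proof (rule summable_comparison_test'[OF sum, of 0])
        fix j
        have "(\<integral>x. norm (?g j x) \<partial>?M) \<le> norm (c j) * Z j"
          using integrable_norm[OF int_g] term_le by (intro integral_torus_le) (simp_all only: norm_g)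
        then show "norm (\<integral>x. norm (?g j x) \<partial>?M) \<le> norm (c j) * Z j"
          by (simp add: integral_nonneg_AE)
      qed
    qed
    moreover have "(\<Sum>j. ?g j x) = cis (- 2 * pi * pair x \<eta>) * f x" for x
      unfolding f_def using summable_norm_cancel[OF abs_sum] by (rule suminf_mult)
    moreover have "integral\<^sup>L ?M (?g j) = c j * fcoef (y j) \<eta>" for j
      unfolding fcoef_mult[symmetric] by (simp add: fcoef_def)
    ultimately show ?thesis by (simp add: fcoef_def)
  qed
  have "(\<Sum>\<eta>\<in>F. japan \<eta> powr w * norm (fcoef f \<eta>)) \<le> (\<Sum>j. norm (c j) * Z j)"
    if F: "finite F" for F :: "(int^'n) set"
  proof -
    let ?t = "\<lambda>\<eta> j. japan \<eta> powr w * norm (c j * fcoef (y j) \<eta>)"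
    have sum_t: "(\<Sum>\<eta>\<in>F. ?t \<eta> j) \<le> norm (c j) * Z j" if "finite F" for F j
      using mult_left_mono[OF wbound[OF that, of j], of "norm (c j)"]
      by (simp add: sum_distrib_left norm_mult mult_ac)
    have t: "summable (?t \<eta>)" for \<eta>
      by (rule summable_comparison_test'[OF sum, of 0]) (use sum_t[of "{\<eta>}"] in \<open>simp add: abs_mult norm_mult\<close>)
    have s: "summable (\<lambda>j. norm (c j * fcoef (y j) \<eta>))" for \<eta>
      using summable_mult[OF t, of "1 / japan \<eta> powr w" \<eta>] by simp
    have "(\<Sum>\<eta>\<in>F. japan \<eta> powr w * norm (fcoef f \<eta>)) \<le> (\<Sum>\<eta>\<in>F. \<Sum>j. ?t \<eta> j)"
    proof (rule sum_mono)
      fix \<eta>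
      have "norm (fcoef f \<eta>) \<le> (\<Sum>j. norm (c j * fcoef (y j) \<eta>))"
        using summable_norm[OF s] fcoef_f by (simp add: sums_iff)
      then show "japan \<eta> powr w * norm (fcoef f \<eta>) \<le> (\<Sum>j. ?t \<eta> j)"
        using s by (subst suminf_mult) (auto intro: mult_left_mono)
    qed
    also have "\<dots> = (\<Sum>j. \<Sum>\<eta>\<in>F. ?t \<eta> j)"
      using t by (intro suminf_sum[symmetric])
    also have "\<dots> \<le> (\<Sum>j. norm (c j) * Z j)"
      using sum_t[OF F] t sum by (intro suminf_le summable_sum) auto
    finally show ?thesis .
  qed
  from Besov_weighted_fcoef[OF w p q int this]
  show "f \<in> Besov_space w p q" "0 \<le> Besov_norm w p q f" "Besov_norm w p q f \<le> (\<Sum>j. norm (c j) * Z j)"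
    by blast+
qed

section \<open>Nuclearity\<close>

lemma symbol_decay:
  fixes a :: "real^'n \<Rightarrow> int^'n \<Rightarrow> complex"
  assumes a: "symbol_class m \<rho> \<delta> (2 * k) a" and \<delta>: "0 \<le> \<delta>"
  obtains D where "D \<ge> 0"
    and "\<And>x \<xi>. norm (a x \<xi>) \<le> D * japan \<xi> powr (m + 2 * real k * \<delta>)"
    and "\<And>\<xi> \<zeta>. norm (fcoef (\<lambda>x. a x \<xi>) \<zeta>) * japan \<zeta> ^ (2 * k) \<le> D * japan \<xi> powr (m + 2 * real k * \<delta>)"
proof -
  let ?\<tau> = "m + 2 * real k * \<delta>"
  have smooth: "smooth (\<lambda>x. a x \<xi>)" and per: "periodic (\<lambda>x. a x \<xi>)" for \<xi>
    using a by (auto simp: symbol_class_def)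
  have bd: "\<exists>C. \<forall>x \<xi>. norm (pds is (\<lambda>y. a y \<xi>) x) \<le> C * japan \<xi> powr (m + \<delta> * real (length is))"
    if "length is \<le> 2 * k" for "is"
    using a that by (auto simp: symbol_class_def)
  obtain C0 where C0: "\<And>x \<xi>. norm (a x \<xi>) \<le> C0 * japan \<xi> powr m"
    using bd[of "[]"] by auto
  have "\<exists>C. \<forall>x \<xi>. norm (pds (replicate (2 * k) i) (\<lambda>y. a y \<xi>) x) \<le> C * japan \<xi> powr ?\<tau>" for i
    using bd[of "replicate (2 * k) i"] by (simp add: mult_ac)
  then obtain C where C: "\<And>i x \<xi>. norm (pds (replicate (2 * k) i) (\<lambda>y. a y \<xi>) x) \<le> C i * japan \<xi> powr ?\<tau>"
    by metis
  have C0_nonneg: "C0 \<ge> 0"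
    using order_trans[OF norm_ge_zero C0[of 0 0]] by (simp add: zero_le_mult_iff)
  have C_nonneg: "C i \<ge> 0" for i
    using order_trans[OF norm_ge_zero C[of i 0 0]] by (simp add: zero_le_mult_iff)
  \<comment> \<open>As \<delta> >= 0 and \<langle>\<xi>\<rangle> >= 1, the bound of order 0 may be
    weakened to the exponent of the bound of order 2k, so that both inputs of
    \<open>fcoef_decay\<close> grow alike.\<close>
  have C0': "norm (a x \<xi>) \<le> C0 * japan \<xi> powr ?\<tau>" for x \<xi>
    using \<delta> C0_nonneg by (intro order_trans[OF C0] mult_left_mono powr_mono japan_ge_1) auto
  \<comment> \<open>The constant produced by \<open>fcoef_decay\<close>; being at least C0, it
    serves the pointwise bound too.\<close>
  define D where "D = (real CARD('n) + 1) ^ k * (C0 + (\<Sum>i\<in>UNIV. C i))"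
  have "1 * C0 \<le> D"
    unfolding D_def using C0_nonneg C_nonneg
    by (intro mult_mono one_le_power) (auto intro: sum_nonneg)
  show ?thesis
  proof (rule that[of D])
    show "D \<ge> 0" using \<open>1 * C0 \<le> D\<close> C0_nonneg by simp
    show "norm (a x \<xi>) \<le> D * japan \<xi> powr ?\<tau>" for x \<xi>
      using \<open>1 * C0 \<le> D\<close> by (intro order_trans[OF C0'] mult_right_mono) auto
    show "norm (fcoef (\<lambda>x. a x \<xi>) \<zeta>) * japan \<zeta> ^ (2 * k) \<le> D * japan \<xi> powr ?\<tau>" for \<xi> \<zeta>
    proof -
      have "norm (fcoef (\<lambda>x. a x \<xi>) \<zeta>) * japan \<zeta> ^ (2 * k)
          \<le> (real CARD('n) + 1) ^ k * (C0 * japan \<xi> powr ?\<tau> + (\<Sum>i\<in>UNIV. C i * japan \<xi> powr ?\<tau>))"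
      proof (rule fcoef_decay[OF smooth per _ C0' C])
        fix i j assume "j \<le> 2 * k"
        then show "\<exists>B. \<forall>x. norm (pds (replicate j i) (\<lambda>x. a x \<xi>) x) \<le> B"
          using bd[of "replicate j i"] by auto
      qed
      then show ?thesis by (simp only: D_def sum_distrib_right[symmetric]) (simp add: algebra_simps)
    qed
  qed
qed

text \<open>With \<zeta> = \<eta> - \<xi>, \<open>japan_add_le\<close> splits the weight at \<eta>.
  The \<xi> part raises the exponent by w; the \<zeta> part, set against the decay, leaves
  \<langle>\<zeta>\<rangle>^(w - 2k), which is summable because 2k - w > n.\<close>

lemma symbol_weighted_fcoef:
  fixes a :: "real^'n \<Rightarrow> int^'n \<Rightarrow> complex"
  assumes a: "symbol_class m \<rho> \<delta> (2 * k) a" and \<delta>: "0 \<le> \<delta>"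
    and w: "0 \<le> w" "w < 2 * real k - CARD('n)"
  obtains K where "K \<ge> 0"
    and "\<And>x \<xi>. norm (cis (2 * pi * pair x \<xi>) * a x \<xi>) \<le> K * japan \<xi> powr (m + 2 * real k * \<delta> + w)"
    and "\<And>\<xi> F. finite F \<Longrightarrow>
      (\<Sum>\<eta>\<in>F. japan \<eta> powr w * norm (fcoef (\<lambda>x. cis (2 * pi * pair x \<xi>) * a x \<xi>) \<eta>))
        \<le> K * japan \<xi> powr (m + 2 * real k * \<delta> + w)"
proof -
  define y where "y = (\<lambda>\<xi> x. cis (2 * pi * pair x \<xi>) * a x \<xi>)"
  define \<sigma> where "\<sigma> = m + 2 * real k * \<delta> + w"
  let ?\<tau> = "m + 2 * real k * \<delta>"
  obtain D where D: "D \<ge> 0" "\<And>x \<xi>. norm (a x \<xi>) \<le> D * japan \<xi> powr ?\<tau>"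
    and D': "\<And>\<xi> \<zeta>. norm (fcoef (\<lambda>x. a x \<xi>) \<zeta>) * japan \<zeta> ^ (2 * k) \<le> D * japan \<xi> powr ?\<tau>"
    by (rule symbol_decay[OF a \<delta>]) (rule that)
  define h :: "int^'n \<Rightarrow> real" where "h \<zeta> = japan \<zeta> powr (- (2 * real k - w))" for \<zeta>
  have h: "h summable_on UNIV"
    unfolding h_def[abs_def] by (rule summable_on_japan_powr) (use w in simp)
  define E where "E = sqrt 2 powr w * D"
  have E: "E \<ge> 0" using D by (simp add: E_def)
  have I: "infsum h UNIV \<ge> 0" by (intro infsum_nonneg) (simp add: h_def)
  have fcoef_y: "japan \<eta> powr w * norm (fcoef (y \<xi>) \<eta>) \<le> E * japan \<xi> powr \<sigma> * h (\<eta> - \<xi>)" for \<xi> \<eta>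
  proof -
    define \<zeta> where "\<zeta> = \<eta> - \<xi>"
    have "japan \<eta> powr w \<le> (sqrt 2 * japan \<xi> * japan \<zeta>) powr w"
      using japan_add_le[of \<xi> \<zeta>] w by (intro powr_mono2) (auto simp: \<zeta>_def less_imp_le)
    also have "\<dots> = sqrt 2 powr w * japan \<xi> powr w * japan \<zeta> powr w"
      by (simp add: powr_mult less_imp_le)
    finally have 1: "japan \<eta> powr w \<le> \<dots>" .
    have "norm (fcoef (y \<xi>) \<eta>) = norm (fcoef (\<lambda>x. a x \<xi>) \<zeta>)"
      by (simp add: y_def \<zeta>_def fcoef_character_mult)
    also have "\<dots> \<le> D * japan \<xi> powr ?\<tau> * japan \<zeta> powr (- 2 * real k)"
      using D'[of \<xi> \<zeta>] japan_pos[of \<zeta>]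
      by (simp add: powr_minus field_simps flip: powr_realpow)
    finally have "japan \<eta> powr w * norm (fcoef (y \<xi>) \<eta>)
        \<le> (sqrt 2 powr w * japan \<xi> powr w * japan \<zeta> powr w) * (D * japan \<xi> powr ?\<tau> * japan \<zeta> powr (- 2 * real k))"
      using 1 by (intro mult_mono) auto
    also have "\<dots> = E * (japan \<xi> powr ?\<tau> * japan \<xi> powr w) * (japan \<zeta> powr w * japan \<zeta> powr (- 2 * real k))"
      by (simp add: E_def mult_ac)
    also have "\<dots> = E * japan \<xi> powr \<sigma> * h \<zeta>"
      unfolding h_def \<sigma>_def powr_add[symmetric] by (simp add: algebra_simps)
    finally show ?thesis by (simp add: \<zeta>_def)
  qed
  \<comment> \<open>One constant for both claims: D for the pointwise bound, the other summand for
    the weighted sums.\<close>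
  define K where "K = D + E * infsum h UNIV"
  have K: "K \<ge> D" "K \<ge> E * infsum h UNIV" using D E I by (auto simp: K_def)
  show ?thesis
  proof (rule that[of K, folded \<sigma>_def])
    show "K \<ge> 0" using K D by simp
    show "norm (cis (2 * pi * pair x \<xi>) * a x \<xi>) \<le> K * japan \<xi> powr \<sigma>" for x \<xi>
    proof -
      have "norm (cis (2 * pi * pair x \<xi>) * a x \<xi>) \<le> D * japan \<xi> powr ?\<tau>" using D by (simp add: norm_mult)
      also have "\<dots> \<le> K * japan \<xi> powr \<sigma>"
        using D K w by (intro mult_mono powr_mono japan_ge_1) (auto simp: \<sigma>_def)
      finally show ?thesis .
    qed
    show "(\<Sum>\<eta>\<in>F. japan \<eta> powr w * norm (fcoef (\<lambda>x. cis (2 * pi * pair x \<xi>) * a x \<xi>) \<eta>)) \<le> K * japan \<xi> powr \<sigma>" if "finite F" for \<xi> F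
    proof -
      have "(\<Sum>\<eta>\<in>F. japan \<eta> powr w * norm (fcoef (\<lambda>x. cis (2 * pi * pair x \<xi>) * a x \<xi>) \<eta>))
          \<le> (\<Sum>\<eta>\<in>F. E * japan \<xi> powr \<sigma> * h (\<eta> - \<xi>))"
        by (intro sum_mono fcoef_y[unfolded y_def])
      also have "\<dots> = E * japan \<xi> powr \<sigma> * (\<Sum>\<zeta>\<in>(\<lambda>\<eta>. \<eta> - \<xi>) ` F. h \<zeta>)"
        by (subst sum.reindex) (auto simp: inj_on_def sum_distrib_left)
      also have "\<dots> \<le> E * japan \<xi> powr \<sigma> * infsum h UNIV"
        using that E by (intro mult_left_mono finite_sum_le_infsum h) (auto simp: h_def)
      also have "\<dots> = (E * infsum h UNIV) * japan \<xi> powr \<sigma>" by simp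
      also have "\<dots> \<le> K * japan \<xi> powr \<sigma>" using K by (intro mult_right_mono) auto
      finally show ?thesis .
    qed
  qed
qed

section \<open>The nuclear decomposition\<close>

lemma ex_bij_nat_lattice: "\<exists>\<xi> :: nat \<Rightarrow> int^'n. bij \<xi>"
proof -
  have "infinite (UNIV :: (int^'n) set)"
  proof
    assume "finite (UNIV :: (int^'n) set)"
    then have "finite (range (\<lambda>k::int. \<chi> i::'n. k))" by (rule finite_subset[rotated]) simp
    then show False
      using finite_imageD[of "\<lambda>k::int. \<chi> i::'n. k" UNIV] infinite_UNIV_int
      by (auto simp: inj_on_def vec_eq_iff)
  qed
  then show ?thesis using bij_betw_from_nat_into[of "UNIV :: (int^'n) set"] by auto
qed

text \<open>Isolates what is used of the source space: its members are integrable, and its unit ball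
  contains 0 and is bounded in L^1. Both choices of X can then be treated at once.\<close>

lemma r_nuclear_Top:
  fixes a :: "real^'n \<Rightarrow> int^'n \<Rightarrow> complex"
  assumes r: "0 < r" "r \<le> 1" and \<delta>: "0 \<le> \<delta>"
    and a: "symbol_class m \<rho> \<delta> (2 * k) a"
    and w: "0 \<le> w" "w < 2 * real k - CARD('n)"
    and m: "m < - real CARD('n) / r - w - 2 * real k * \<delta>"
    and p: "1 \<le> p" and q: "1 \<le> q"
    and X_int: "\<And>u. u \<in> X \<Longrightarrow> integrable torus_measure u"
    and X_zero: "(\<lambda>x. 0) \<in> X" "nX (\<lambda>x. 0) \<le> 1"
    and X_bound: "\<And>u. u \<in> X \<Longrightarrow> nX u \<le> 1 \<Longrightarrow> integral\<^sup>L torus_measure (\<lambda>x. norm (u x)) \<le> B"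
  shows "r_nuclear r X nX (Besov_space w p q) (Besov_norm w p q) (Top a)"
proof -
  obtain \<xi> :: "nat \<Rightarrow> int^'n" where \<xi>: "bij \<xi>" using ex_bij_nat_lattice by blast
  define \<sigma> where "\<sigma> = m + 2 * real k * \<delta> + w"
  define y where "y j x = cis (2 * pi * pair x (\<xi> j)) * a x (\<xi> j)" for j x
  obtain K where K: "K \<ge> 0"
    and "\<And>x \<xi>. norm (cis (2 * pi * pair x \<xi>) * a x \<xi>) \<le> K * japan \<xi> powr \<sigma>"
    and "\<And>\<xi> F. finite F \<Longrightarrow>
      (\<Sum>\<eta>\<in>F. japan \<eta> powr w * norm (fcoef (\<lambda>x. cis (2 * pi * pair x \<xi>) * a x \<xi>) \<eta>)) \<le> K * japan \<xi> powr \<sigma>"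
    by (rule symbol_weighted_fcoef[OF a \<delta> w, folded \<sigma>_def]) (rule that)
  then have y_le: "norm (y j x) \<le> K * japan (\<xi> j) powr \<sigma>"
    and y_fcoef: "finite F \<Longrightarrow> (\<Sum>\<eta>\<in>F. japan \<eta> powr w * norm (fcoef (y j) \<eta>)) \<le> K * japan (\<xi> j) powr \<sigma>" for j x F
    by (auto simp: y_def[abs_def])
  have y_cont: "continuous_on UNIV (y j)" for j
  proof -
    have "smooth (\<lambda>x. a x (\<xi> j))" using a by (simp add: symbol_class_def)
    then have "continuous_on UNIV (pds [] (\<lambda>x. a x (\<xi> j)))" unfolding smooth_def by blast
    then show ?thesis
      unfolding y_def by (intro continuous_intros continuous_on_character) simp
  qed
  define e where "e j u = fcoef u (\<xi> j)" for j and u :: "real^'n \<Rightarrow> complex"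
  have summable_japan: "summable (\<lambda>j. japan (\<xi> j) powr s)" if "s < - real CARD('n)" for s
  proof -
    have "(\<lambda>\<xi>::int^'n. japan \<xi> powr - (- s)) summable_on UNIV"
      by (rule summable_on_japan_powr) (use that in simp)
    then have "(\<lambda>j. japan (\<xi> j) powr s) summable_on UNIV"
      using summable_on_reindex_bij_betw[OF \<xi>, of "\<lambda>\<xi>. japan \<xi> powr s"] by simp
    then show ?thesis by (rule summable_on_imp_summable)
  qed
  have \<sigma>: "\<sigma> < - real CARD('n) / r" using m by (simp add: \<sigma>_def)
  then have \<sigma>r: "\<sigma> * r < - real CARD('n)" using r by (simp add: field_simps)
  \<comment> \<open>Since r <= 1, the exponent lies below -n as well; the r-th powers need \<sigma>
    r < -n, absolute convergence of the series for T_a u needs \<sigma> < -n.\<close>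
  have "real CARD('n) * r \<le> real CARD('n) * 1" using r by (intro mult_left_mono) auto
  then have \<sigma>1: "\<sigma> < - real CARD('n)"
    using r by (intro less_le_trans[OF \<sigma>]) (simp add: field_simps)

  have e_add: "e j (\<lambda>x. u x + v x) = e j u + e j v" if "u \<in> X" "v \<in> X" for j u v
    using fcoef_add[OF X_int X_int] that by (simp add: e_def)
  have e_bound: "norm (e j u) \<le> B" if "u \<in> X" "nX u \<le> 1" for j u
    using order_trans[OF norm_fcoef_le X_bound[OF that]] by (simp add: e_def)
  have e_cont: "continuous_functional X nX (e j)" for j
    unfolding continuous_functional_def clinear_on_def
    using e_add e_bound by (auto simp: e_def fcoef_mult intro!: bdd_aboveI[where M = B])
  \<comment> \<open>The zero function keeps the set under \<open>Sup\<close> nonempty and makes the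
    dual norm nonnegative, as monotonicity of \<open>powr\<close> requires.\<close>
  have dual: "0 \<le> dual_norm X nX (e j)" "dual_norm X nX (e j) \<le> B" for j
  proof -
    show "dual_norm X nX (e j) \<le> B"
      unfolding dual_norm_def using X_zero e_bound by (intro cSup_least) auto
    have "bdd_above ((\<lambda>u. norm (e j u)) ` {u \<in> X. nX u \<le> 1})"
      using e_bound by (auto intro!: bdd_aboveI[where M = B])
    then have "norm (e j (\<lambda>x. 0)) \<le> dual_norm X nX (e j)"
      unfolding dual_norm_def using X_zero by (intro cSup_upper) auto
    then show "0 \<le> dual_norm X nX (e j)" by (rule order_trans[OF norm_ge_zero])
  qed
  have y_Besov: "y j \<in> Besov_space w p q" "0 \<le> Besov_norm w p q (y j)"
    "Besov_norm w p q (y j) \<le> K * japan (\<xi> j) powr \<sigma>" for j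
    using Besov_weighted_fcoef[OF w(1) p q integrable_torus_continuous[OF y_cont] y_fcoef] by blast+
  have "summable (\<lambda>j. dual_norm X nX (e j) powr r * Besov_norm w p q (y j) powr r)"
  proof (rule summable_comparison_test')
    show "summable (\<lambda>j. B powr r * K powr r * japan (\<xi> j) powr (\<sigma> * r))"
      by (intro summable_mult summable_japan \<sigma>r)
    show "norm (dual_norm X nX (e j) powr r * Besov_norm w p q (y j) powr r)
        \<le> B powr r * K powr r * japan (\<xi> j) powr (\<sigma> * r)" for j
    proof -
      have "dual_norm X nX (e j) powr r * Besov_norm w p q (y j) powr r
          \<le> B powr r * (K * japan (\<xi> j) powr \<sigma>) powr r"
        using dual y_Besov r by (intro mult_mono powr_mono2) auto
      then show ?thesis using K by (simp add: powr_mult powr_powr abs_mult)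
    qed
  qed

  moreover have "Top a u \<in> Besov_space w p q"
    and "(\<lambda>N. Besov_norm w p q (\<lambda>x. Top a u x - (\<Sum>j<N. e j u * y j x))) \<longlonglongrightarrow> 0" if "u \<in> X" for u
  proof -
    define Z where "Z j = K * japan (\<xi> j) powr \<sigma>" for j
    \<comment> \<open>For fixed u its L^1 norm bounds all e_j(u), without rescaling u into the unit
      ball of X.\<close>
    define A where "A = integral\<^sup>L torus_measure (\<lambda>x. norm (u x))"
    have e_le: "norm (e j u) \<le> A" for j by (simp add: e_def A_def norm_fcoef_le)
    have sum_Z: "summable (\<lambda>j. norm (e j u) * Z j)"
    proof (rule summable_comparison_test')
      show "summable (\<lambda>j. A * (K * japan (\<xi> j) powr \<sigma>))"
        by (intro summable_mult summable_japan \<sigma>1)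
      show "norm (norm (e j u) * Z j) \<le> A * (K * japan (\<xi> j) powr \<sigma>)" for j
        using e_le K by (auto simp: Z_def abs_mult intro!: mult_right_mono)
    qed
    have abs_sum: "summable (\<lambda>j. norm (e j u * y j x))" for x
      by (rule summable_comparison_test'[OF sum_Z, of 0])
         (auto simp: norm_mult abs_mult Z_def intro!: mult_left_mono y_le)
    \<comment> \<open>Absolute convergence lets the unordered sum over the lattice be taken in the
      order of the enumeration.\<close>
    have Top: "Top a u x = (\<Sum>j. e j u * y j x)" for x
    proof -
      have "Top a u x = (\<Sum>\<^sub>\<infinity>j. e j u * y j x)"
        unfolding Top_def
        using infsum_reindex_bij_betw[OF \<xi>, of "\<lambda>\<xi>. cis (2 * pi * pair x \<xi>) * a x \<xi> * fcoef u \<xi>"]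
        by (simp add: e_def y_def mult_ac)
      also have "(\<lambda>j. e j u * y j x) sums \<dots>"
        by (intro has_sum_imp_sums has_sum_infsum norm_summable_imp_summable_on abs_sum)
      then have "(\<Sum>\<^sub>\<infinity>j. e j u * y j x) = (\<Sum>j. e j u * y j x)" by (simp add: sums_iff)
      finally show ?thesis .
    qed
    \<comment> \<open>A remainder is a series of the same kind, so \<open>Besov_suminf\<close>
      bounds its norm by the tail of a convergent real series.\<close>
    define R where "R N x = (\<Sum>j. e (j + N) u * y (j + N) x)" for N x
    have R: "R N \<in> Besov_space w p q" "0 \<le> Besov_norm w p q (R N)"
      "Besov_norm w p q (R N) \<le> (\<Sum>j. norm (e (j + N) u) * Z (j + N))" for N
    proof -
      have "summable (\<lambda>j. norm (e (j + N) u) * Z (j + N))"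
        using sum_Z by (rule summable_ignore_initial_segment)
      note * = Besov_suminf[OF w(1) p q y_cont y_le[folded Z_def] y_fcoef[folded Z_def] this]
      show "R N \<in> Besov_space w p q" "0 \<le> Besov_norm w p q (R N)"
        "Besov_norm w p q (R N) \<le> (\<Sum>j. norm (e (j + N) u) * Z (j + N))"
        unfolding R_def[abs_def] using * by blast+
    qed
    have tail: "(\<lambda>x. Top a u x - (\<Sum>j<N. e j u * y j x)) = R N" for N
    proof
      fix x show "Top a u x - (\<Sum>j<N. e j u * y j x) = R N x"
        unfolding Top R_def using suminf_minus_initial_segment[OF summable_norm_cancel[OF abs_sum[of x]], of N] by simp
    qed
    \<comment> \<open>The remainder at N = 0 is T_a u itself.\<close>
    show "Top a u \<in> Besov_space w p q"
      using R(1)[of 0] tail[of 0] by simp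
    have "(\<lambda>N. (\<Sum>j. norm (e j u) * Z j) - (\<Sum>j<N. norm (e j u) * Z j)) \<longlonglongrightarrow>
        (\<Sum>j. norm (e j u) * Z j) - (\<Sum>j. norm (e j u) * Z j)"
      by (intro tendsto_intros summable_LIMSEQ sum_Z)
    then have "(\<lambda>N. \<Sum>j. norm (e (j + N) u) * Z (j + N)) \<longlonglongrightarrow> 0"
      by (simp add: suminf_minus_initial_segment[OF sum_Z])
    then have "(\<lambda>N. Besov_norm w p q (R N)) \<longlonglongrightarrow> 0"
      by (rule tendsto_sandwich[OF _ _ tendsto_const, rotated 2]) (use R in auto)
    then show "(\<lambda>N. Besov_norm w p q (\<lambda>x. Top a u x - (\<Sum>j<N. e j u * y j x))) \<longlonglongrightarrow> 0"
      by (simp add: tail)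
  qed
  ultimately show ?thesis
    unfolding r_nuclear_def using e_cont y_Besov(1) by blast
qed

section \<open>The source spaces embed into L^1\<close>

lemma Lp_space_L1:
  fixes u :: "real^'n \<Rightarrow> complex"
  assumes p: "1 \<le> p" and u: "u \<in> Lp_space p"
  shows "integrable torus_measure u"
    and "Lp_norm p u \<le> 1 \<Longrightarrow> integral\<^sup>L torus_measure (\<lambda>x. norm (u x)) \<le> 2"
proof -
  let ?M = "torus_measure :: (real^'n) measure"
  have meas: "u \<in> borel_measurable ?M" and int: "integrable ?M (\<lambda>x. norm (u x) powr p)"
    using u by (auto simp: Lp_space_def)
  \<comment> \<open>This elementary bound stands in for Hoelder's inequality; integrated over
    measure 1 it bounds the unit ball of L^p by 1 + 1 = 2 in L^1.\<close>
  have le: "norm (u x) \<le> 1 + norm (u x) powr p" for x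
  proof (cases "norm (u x) \<le> 1")
    case False
    then have "norm (u x) powr 1 \<le> norm (u x) powr p" using p by (intro powr_mono) auto
    then show ?thesis by simp
  qed (simp add: add_increasing2)
  have int1: "integrable ?M (\<lambda>x. 1 + norm (u x) powr p)"
    using int finite_measure.integrable_const[OF finite_measure_torus] by (intro Bochner_Integration.integrable_add) auto
  show "integrable ?M u"
    by (rule Bochner_Integration.integrable_bound[OF int1 meas]) (use le in \<open>auto intro!: AE_I2\<close>)
  assume *: "Lp_norm p u \<le> 1"
  have "integral\<^sup>L ?M (\<lambda>x. norm (u x) powr p) \<le> 1"
  proof (rule ccontr)
    assume "\<not> ?thesis"
    then have "1 powr (1 / p) < Lp_norm p u"
      unfolding Lp_norm_def using p by (intro powr_less_mono2) auto
    with * show False by simp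
  qed
  have "integral\<^sup>L ?M (\<lambda>x. norm (u x)) \<le> integral\<^sup>L ?M (\<lambda>x. 1 + norm (u x) powr p)"
    using \<open>integrable ?M u\<close> int1 le by (intro integral_mono) auto
  also have "\<dots> = 1 + integral\<^sup>L ?M (\<lambda>x. norm (u x) powr p)"
    using Bochner_Integration.integral_add[OF finite_measure.integrable_const[OF finite_measure_torus, of 1] int] by simp
  also have "\<dots> \<le> 2" using \<open>integral\<^sup>L ?M (\<lambda>x. norm (u x) powr p) \<le> 1\<close> by simp
  finally show "integral\<^sup>L ?M (\<lambda>x. norm (u x)) \<le> 2" .
qed

text \<open>\<open>Holder_space\<close> does not mention measurability; continuity supplies it, and
  with it integrability over the cube.\<close>

lemma Holder_space_continuous:
  fixes u :: "real^'n \<Rightarrow> complex"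
  assumes s: "0 < s" and u: "u \<in> Holder_space s"
  shows "continuous_on UNIV u"
proof -
  obtain C where C: "\<And>x h. h \<noteq> 0 \<Longrightarrow> norm (u (x + h) - u x) / norm h powr s \<le> C"
    using u by (fastforce simp: Holder_space_def bdd_above_def)
  have "(u \<longlongrightarrow> u x) (at x)" for x
  proof (rule LIM_zero_cancel, rule Lim_null_comparison)
    show "\<forall>\<^sub>F y in at x. norm (u y - u x) \<le> C * norm (y - x) powr s"
      unfolding eventually_at_filter
    proof (intro always_eventually allI impI)
      fix y assume "y \<noteq> x"
      then show "norm (u y - u x) \<le> C * norm (y - x) powr s"
        using C[of "y - x" x] by (simp add: field_simps)
    qed
    have "((\<lambda>y. C * norm (y - x) powr s) \<longlongrightarrow> C * norm (x - x) powr s) (at x)"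
      using s by (intro tendsto_intros tendsto_powr') auto
    then show "((\<lambda>y. C * norm (y - x) powr s) \<longlongrightarrow> 0) (at x)" by simp
  qed
  then show ?thesis by (simp add: continuous_on_def)
qed

lemma Holder_norm_bound:
  fixes u :: "real^'n \<Rightarrow> complex"
  assumes u: "u \<in> Holder_space s"
  shows "norm (u x) \<le> Holder_norm s u"
proof -
  let ?S = "{norm (u (x + h) - u x) / norm h powr s | x h. h \<noteq> 0}"
  \<comment> \<open>The increment \<open>1\<close>, the vector of ones, gives a member of the set of
    quotients; its supremum is thus at least a nonnegative number.\<close>
  have "norm (u (0 + 1) - u 0) / norm (1 :: real^'n) powr s \<le> Sup ?S"
  proof (rule cSup_upper)
    have "(1 :: real^'n) \<noteq> 0" by (simp add: vec_eq_iff)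
    then show "norm (u (0 + 1) - u 0) / norm (1 :: real^'n) powr s \<in> ?S" by blast
  qed (use u in \<open>simp add: Holder_space_def\<close>)
  then have "0 \<le> Sup ?S" by (rule order_trans[rotated]) simp
  moreover have "norm (u x) \<le> (SUP x. norm (u x))"
    using u by (intro cSUP_upper) (auto simp: Holder_space_def)
  ultimately show ?thesis by (simp add: Holder_norm_def)
qed

theorem theorem3p6:
  fixes a :: "real^'n \<Rightarrow> int^'n \<Rightarrow> complex"
    and r \<rho> \<delta> m w2 :: real and k :: nat and p2 q2 :: ereal
    and X :: "(real^'n \<Rightarrow> complex) set" and nX :: "(real^'n \<Rightarrow> complex) \<Rightarrow> real"
  assumes "0 < r" "r \<le> 1"
    and "0 \<le> \<rho>" "\<rho> \<le> 1" "0 \<le> \<delta>" "\<delta> \<le> 1"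
    and "real k > real CARD('n) / 2"
    and "symbol_class m \<rho> \<delta> (2 * k) a"
    and "(\<exists>p. 1 \<le> p \<and> p \<le> 2 \<and> X = Lp_space p \<and> nX = Lp_norm p) \<or>
         (CARD('n) = 1 \<and> (\<exists>s. 0 < s \<and> s < 1 \<and> X = Holder_space s \<and> nX = Holder_norm s))"
    and "0 \<le> w2" "w2 < 2 * real k - real CARD('n)"
    and "m < - real CARD('n) / r - w2 - 2 * real k * \<delta>"
    and "1 \<le> p2" and "1 \<le> q2"
  shows "r_nuclear r X nX (Besov_space w2 p2 q2) (Besov_norm w2 p2 q2) (Top a)"
  using assms(9)
proof (elim disjE exE conjE)
  fix p assume p: "1 \<le> p" and X: "X = Lp_space p" "nX = Lp_norm p"
  show ?thesis
  proof (rule r_nuclear_Top[OF assms(1,2,5,8,10-14)])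
    show "(\<lambda>x. 0) \<in> X" "nX (\<lambda>x. 0) \<le> 1"
      using p by (auto simp: X Lp_space_def Lp_norm_def)
    show "integrable torus_measure u" if "u \<in> X" for u
      using Lp_space_L1(1)[OF p] that by (simp add: X)
    show "integral\<^sup>L torus_measure (\<lambda>x. norm (u x)) \<le> 2" if "u \<in> X" "nX u \<le> 1" for u
      using Lp_space_L1(2)[OF p] that by (simp add: X)
  qed
next
  fix s assume s: "0 < s" and X: "X = Holder_space s" "nX = Holder_norm s"
  show ?thesis
  proof (rule r_nuclear_Top[OF assms(1,2,5,8,10-14)])
    \<comment> \<open>For u = 0 all quotients are 0; a nonzero increment exists, so the supremum is
      over {0} and not over the empty set.\<close>
    have "{0 :: real | x h :: real^'n. h \<noteq> 0} = {0}"
      using exI[of "\<lambda>h :: real^'n. h \<noteq> 0" 1] by auto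
    then show "(\<lambda>x. 0) \<in> X" "nX (\<lambda>x. 0) \<le> 1"
      by (auto simp: X Holder_space_def Holder_norm_def periodic_def)
    show int: "integrable torus_measure u" if "u \<in> X" for u
      using integrable_torus_continuous[OF Holder_space_continuous[OF s]] that by (simp add: X)
    \<comment> \<open>The Hoelder norm controls the sup norm and the cube has measure 1, so B = 1
      here.\<close>
    show "integral\<^sup>L torus_measure (\<lambda>x. norm (u x)) \<le> 1" if "u \<in> X" "nX u \<le> 1" for u
      using int[OF that(1)] order_trans[OF Holder_norm_bound] that
      by (intro integral_torus_le) (auto simp: X)
  qed
qed

end
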